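(* Assume the continuum hypothesis. If $K$ is a nonmetrizable linearly ordered compact space, then there is a nontrivial twisted sum of $c_0$ and $C(K)$.
   Context: A linearly ordered compact space is a compact space whose topology is the order topology of some linear order. $C(K)$ is the Banach space of continuous real-valued functions on $K$. A twisted sum of Banach spaces $Z$ and $Y$ is a short exact sequence $0\to Z\to X\to Y\to 0$ with $X$ a Banach space and the maps bounded linear operators; it is trivial if it splits (the map $Z\to X$ has a bounded linear left inverse; equivalently, its range is complemented in $X$), and nontrivial otherwise. *)

theory Defs
  imports "HOL-Analysis.Analysis"
begin

section \<open>The continuum hypothesis\<close>

context
  includes cardinal_syntax
begin

definition continuum_hypothesis :: bool where
  "continuum_hypothesis \<longleftrightarrow> |UNIV :: real set| =o cardSuc natLeq"

end

section \<open>Banach spaces with an explicit carrier\<close>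

text \<open>The middle term of a twisted sum is an existentially quantified Banach space. HOL cannot
  quantify over types inside a formula, so Banach spaces are represented by records.\<close>

record 'x nspace =
  pts :: "'x set"
  vadd :: "'x \<Rightarrow> 'x \<Rightarrow> 'x"
  vzero :: "'x"
  vscale :: "real \<Rightarrow> 'x \<Rightarrow> 'x"
  vnorm :: "'x \<Rightarrow> real"

definition vdist :: "('x, 'm) nspace_scheme \<Rightarrow> 'x \<Rightarrow> 'x \<Rightarrow> real" where
  "vdist E x y = vnorm E (vadd E x (vscale E (-1) y))"

locale normed_space_on =
  fixes E :: "('x, 'm) nspace_scheme"
  assumes zero_closed: "vzero E \<in> pts E"
    and add_closed: "\<lbrakk>x \<in> pts E; y \<in> pts E\<rbrakk> \<Longrightarrow> vadd E x y \<in> pts E"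
    and scale_closed: "x \<in> pts E \<Longrightarrow> vscale E a x \<in> pts E"
    and add_assoc: "\<lbrakk>x \<in> pts E; y \<in> pts E; z \<in> pts E\<rbrakk>
          \<Longrightarrow> vadd E (vadd E x y) z = vadd E x (vadd E y z)"
    and add_commute: "\<lbrakk>x \<in> pts E; y \<in> pts E\<rbrakk> \<Longrightarrow> vadd E x y = vadd E y x"
    and add_zero: "x \<in> pts E \<Longrightarrow> vadd E x (vzero E) = x"
    and add_inverse: "x \<in> pts E \<Longrightarrow> \<exists>y\<in>pts E. vadd E x y = vzero E"
    and scale_add_right: "\<lbrakk>x \<in> pts E; y \<in> pts E\<rbrakk>
          \<Longrightarrow> vscale E a (vadd E x y) = vadd E (vscale E a x) (vscale E a y)"
    and scale_add_left: "x \<in> pts E \<Longrightarrow> vscale E (a + b) x = vadd E (vscale E a x) (vscale E b x)"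
    and scale_scale: "x \<in> pts E \<Longrightarrow> vscale E a (vscale E b x) = vscale E (a * b) x"
    and scale_one: "x \<in> pts E \<Longrightarrow> vscale E 1 x = x"
    and norm_eq_zero: "x \<in> pts E \<Longrightarrow> vnorm E x = 0 \<longleftrightarrow> x = vzero E"
    and norm_scale: "x \<in> pts E \<Longrightarrow> vnorm E (vscale E a x) = \<bar>a\<bar> * vnorm E x"
    and norm_triangle: "\<lbrakk>x \<in> pts E; y \<in> pts E\<rbrakk> \<Longrightarrow> vnorm E (vadd E x y) \<le> vnorm E x + vnorm E y"

locale banach_space_on = normed_space_on +
  assumes complete: "\<lbrakk>range s \<subseteq> pts E; \<forall>e>0. \<exists>N. \<forall>m\<ge>N. \<forall>n\<ge>N. vdist E (s m) (s n) < e\<rbrakk>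
          \<Longrightarrow> \<exists>l\<in>pts E. (\<lambda>n. vdist E (s n) l) \<longlonglongrightarrow> 0"

definition bounded_linear_on ::
    "('x, 'm) nspace_scheme \<Rightarrow> ('y, 'n) nspace_scheme \<Rightarrow> ('x \<Rightarrow> 'y) \<Rightarrow> bool" where
  "bounded_linear_on E F T \<longleftrightarrow>
     T ` pts E \<subseteq> pts F \<and>
     (\<forall>x\<in>pts E. \<forall>y\<in>pts E. T (vadd E x y) = vadd F (T x) (T y)) \<and>
     (\<forall>a. \<forall>x\<in>pts E. T (vscale E a x) = vscale F a (T x)) \<and>
     (\<exists>B. \<forall>x\<in>pts E. vnorm F (T x) \<le> B * vnorm E x)"

definition nspace_of :: "'b::real_normed_vector itself \<Rightarrow> 'b nspace" where
  "nspace_of _ = \<lparr>pts = UNIV, vadd = (+), vzero = 0, vscale = (*\<^sub>R), vnorm = norm\<rparr>"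

section \<open>Twisted sums\<close>

text \<open>\<open>twisted_sum Z Y X i q\<close>: the sequence \<open>0 \<rightarrow> Z \<rightarrow> X \<rightarrow> Y \<rightarrow> 0\<close> with maps \<open>i\<close> and \<open>q\<close> is a
  short exact sequence of Banach spaces and bounded operators.\<close>

definition twisted_sum ::
    "('z, 'k) nspace_scheme \<Rightarrow> ('y, 'l) nspace_scheme \<Rightarrow> ('x, 'm) nspace_scheme
      \<Rightarrow> ('z \<Rightarrow> 'x) \<Rightarrow> ('x \<Rightarrow> 'y) \<Rightarrow> bool" where
  "twisted_sum Z Y X i q \<longleftrightarrow>
     banach_space_on Z \<and> banach_space_on Y \<and> banach_space_on X \<and>
     bounded_linear_on Z X i \<and> bounded_linear_on X Y q \<and>
     inj_on i (pts Z) \<and> i ` pts Z = {x \<in> pts X. q x = vzero Y} \<and> q ` pts X = pts Y"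

definition splits :: "('z, 'k) nspace_scheme \<Rightarrow> ('x, 'm) nspace_scheme \<Rightarrow> ('z \<Rightarrow> 'x) \<Rightarrow> bool" where
  "splits Z X i \<longleftrightarrow> (\<exists>r. bounded_linear_on X Z r \<and> (\<forall>z\<in>pts Z. r (i z) = z))"

text \<open>The underlying set of a twisted sum of \<open>Z\<close> and \<open>Y\<close> is in bijection with \<open>Z \<times> Y\<close>, so
  existence may be stated with the points of \<open>X\<close> taken from the product type; see
  \<open>nontrivial_twisted_sumI\<close> below.\<close>

definition nontrivial_twisted_sum_exists ::
    "('z, 'k) nspace_scheme \<Rightarrow> ('y, 'l) nspace_scheme \<Rightarrow> bool" where
  "nontrivial_twisted_sum_exists Z Y \<longleftrightarrow>
     (\<exists>(X :: ('z \<times> 'y) nspace) i q. twisted_sum Z Y X i q \<and> \<not> splits Z X i)"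

lemma (in normed_space_on) add_right_cancel:
  assumes "x \<in> pts E" "y \<in> pts E" "z \<in> pts E" "vadd E x z = vadd E y z"
  shows "x = y"
proof -
  obtain w where w: "w \<in> pts E" "vadd E z w = vzero E"
    using add_inverse assms(3) by blast
  have "x = vadd E (vadd E x z) w"
    using assms(1,3) w by (simp add: add_assoc add_zero)
  also have "\<dots> = vadd E (vadd E y z) w"
    unfolding assms(4) ..
  also have "\<dots> = y"
    using assms(2,3) w by (simp add: add_assoc add_zero)
  finally show ?thesis .
qed

lemma (in normed_space_on) scale_zero_left:
  assumes "x \<in> pts E"
  shows "vscale E 0 x = vzero E"
proof -
  have "vnorm E (vscale E 0 x) = 0"
    using norm_scale[OF assms, of 0] by simp
  then show ?thesis
    using norm_eq_zero[OF scale_closed[OF assms, of 0]] by simp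
qed

lemma (in normed_space_on) add_minus:
  assumes "x \<in> pts E"
  shows "vadd E x (vscale E (-1) x) = vzero E"
proof -
  have "vadd E x (vscale E (-1) x) = vscale E (1 + -1) x"
    unfolding scale_add_left[OF assms] scale_one[OF assms] ..
  then show ?thesis by (simp add: scale_zero_left[OF assms])
qed

lemma transport_twisted_sum:
  fixes X :: "('x, 'm) nspace_scheme" and h :: "'x \<Rightarrow> 'w"
  assumes ts: "twisted_sum Z Y X i q" and inj: "inj_on h (pts X)"
  obtains X' :: "'w nspace" and i' q'
  where "twisted_sum Z Y X' i' q'" "splits Z X' i' \<longleftrightarrow> splits Z X i"
proof -
  define g where "g = inv_into (pts X) h"
  have gh [simp]: "g (h x) = x" if "x \<in> pts X" for x
    using that inj by (simp add: g_def)
  define X' where "X' = \<lparr>pts = h ` pts X, vadd = \<lambda>a b. h (vadd X (g a) (g b)), vzero = h (vzero X),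
     vscale = \<lambda>c a. h (vscale X c (g a)), vnorm = \<lambda>a. vnorm X (g a)\<rparr>"
  have X'_sel: "pts X' = h ` pts X" "vadd X' = (\<lambda>a b. h (vadd X (g a) (g b)))"
     "vzero X' = h (vzero X)" "vscale X' = (\<lambda>c a. h (vscale X c (g a)))"
     "vnorm X' = (\<lambda>a. vnorm X (g a))"
    by (simp_all add: X'_def)
  interpret X: banach_space_on X
    using ts by (simp add: twisted_sum_def)
  note cl [simp] = X.zero_closed X.add_closed X.scale_closed
  have hinj: "h x = h y \<longleftrightarrow> x = y" if "x \<in> pts X" "y \<in> pts X" for x y
    using that inj by (auto simp: inj_on_def)
  have nX': "normed_space_on X'"
  proof
    fix x y a
    assume "x \<in> pts X'"
    then obtain u where u: "u \<in> pts X" "x = h u"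
      by (auto simp: X'_sel)
    obtain w where "w \<in> pts X" "vadd X u w = vzero X"
      using X.add_inverse u by blast
    then have "h w \<in> pts X'" "vadd X' x (h w) = vzero X'"
      using u by (simp_all add: X'_sel)
    then show "\<exists>y\<in>pts X'. vadd X' x y = vzero X'" by blast
    assume "y \<in> pts X'"
    then obtain v where "v \<in> pts X" "y = h v"
      by (auto simp: X'_sel)
    with u show "vadd X' x y = vadd X' y x"
      using X.add_commute[of u v] by (simp add: X'_sel)
  qed (auto simp: X'_sel hinj X.add_assoc X.add_zero X.scale_add_right X.scale_add_left
        X.scale_scale X.scale_one X.norm_eq_zero X.norm_scale X.norm_triangle)
  have dist': "vdist X' (h x) (h y) = vdist X x y" if "x \<in> pts X" "y \<in> pts X" for x y
    using that by (simp add: vdist_def X'_sel)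
  have "banach_space_on X'"
  proof (rule banach_space_on.intro[OF nX'], unfold_locales)
    fix s :: "nat \<Rightarrow> 'w"
    assume s: "range s \<subseteq> pts X'"
      and C: "\<forall>e>0. \<exists>N. \<forall>m\<ge>N. \<forall>n\<ge>N. vdist X' (s m) (s n) < e"
    define t where "t = g \<circ> s"
    have t: "t n \<in> pts X" "s n = h (t n)" for n
    proof -
      have "s n \<in> h ` pts X" using s by (auto simp: X'_sel)
      then show "t n \<in> pts X" "s n = h (t n)" by (auto simp: t_def)
    qed
    have "\<exists>l\<in>pts X. (\<lambda>n. vdist X (t n) l) \<longlonglongrightarrow> 0"
    proof (rule X.complete)
      show "range t \<subseteq> pts X" using t by blast
      show "\<forall>e>0. \<exists>N. \<forall>m\<ge>N. \<forall>n\<ge>N. vdist X (t m) (t n) < e"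
        using C by (simp add: t dist')
    qed
    then show "\<exists>l\<in>pts X'. (\<lambda>n. vdist X' (s n) l) \<longlonglongrightarrow> 0"
      using t by (auto simp: dist' X'_sel(1))
  qed
  moreover have "bounded_linear_on Z X' (h \<circ> i)"
  proof -
    have "bounded_linear_on Z X i" using ts by (simp add: twisted_sum_def)
    then show ?thesis by (auto simp: bounded_linear_on_def X'_sel image_subset_iff)
  qed
  moreover have "bounded_linear_on X' Y (q \<circ> g)"
    using ts by (auto simp: twisted_sum_def bounded_linear_on_def X'_sel image_subset_iff)
  moreover have "inj_on (h \<circ> i) (pts Z)"
  proof -
    have "i ` pts Z \<subseteq> pts X" "inj_on i (pts Z)"
      using ts by (auto simp: twisted_sum_def)
    then show ?thesis
      using inj by (metis comp_inj_on inj_on_subset)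
  qed
  moreover have "(h \<circ> i) ` pts Z = {x \<in> pts X'. (q \<circ> g) x = vzero Y}"
  proof -
    have "i ` pts Z = {x \<in> pts X. q x = vzero Y}"
      using ts by (simp add: twisted_sum_def)
    then show ?thesis
      unfolding image_comp[symmetric] by (auto simp: X'_sel)
  qed
  moreover have "(q \<circ> g) ` pts X' = pts Y"
  proof -
    have "g ` h ` pts X = pts X" by (force simp: image_iff)
    then show ?thesis
      using ts unfolding image_comp[symmetric] by (simp add: X'_sel(1) twisted_sum_def)
  qed
  ultimately have 1: "twisted_sum Z Y X' (h \<circ> i) (q \<circ> g)"
    using ts by (simp add: twisted_sum_def)
  have iX: "i z \<in> pts X" if "z \<in> pts Z" for z
    using ts that by (auto simp: twisted_sum_def)
  have blh: "bounded_linear_on X Z (r \<circ> h)" if "bounded_linear_on X' Z r" for r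
    using that by (auto simp: bounded_linear_on_def X'_sel image_subset_iff)
  have 2: "splits Z X' (h \<circ> i) \<longleftrightarrow> splits Z X i"
  proof
    assume "splits Z X' (h \<circ> i)"
    then obtain r where "bounded_linear_on X' Z r" "\<forall>z\<in>pts Z. r (h (i z)) = z"
      by (auto simp: splits_def)
    then show "splits Z X i"
      unfolding splits_def using blh by (intro exI[of _ "r \<circ> h"]) auto
  next
    assume "splits Z X i"
    then obtain r where r: "bounded_linear_on X Z r" "\<forall>z\<in>pts Z. r (i z) = z"
      by (auto simp: splits_def)
    have "bounded_linear_on X' Z (r \<circ> g)"
      using r(1) by (auto simp: bounded_linear_on_def X'_sel image_subset_iff)
    then show "splits Z X' (h \<circ> i)"
      unfolding splits_def using r(2) iX by (intro exI[of _ "r \<circ> g"]) auto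
  qed
  from 1 2 show thesis by (rule that)
qed

text \<open>A nontrivial twisted sum with points in an arbitrary type suffices.\<close>

lemma nontrivial_twisted_sumI:
  fixes Z :: "('z, 'k) nspace_scheme" and Y :: "('y, 'l) nspace_scheme"
    and X :: "('x, 'm) nspace_scheme"
  assumes ts: "twisted_sum Z Y X i q" and ns: "\<not> splits Z X i"
  shows "nontrivial_twisted_sum_exists Z Y"
proof -
  interpret X: banach_space_on X
    using ts by (simp add: twisted_sum_def)
  interpret Y: banach_space_on Y
    using ts by (simp add: twisted_sum_def)
  have q: "q x \<in> pts Y" "q (vadd X x y) = vadd Y (q x) (q y)"
      "q (vscale X a x) = vscale Y a (q x)"
    if "x \<in> pts X" "y \<in> pts X" for x y a
    using ts that by (auto simp: twisted_sum_def bounded_linear_on_def)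
  have ker: "i ` pts Z = {x \<in> pts X. q x = vzero Y}"
    using ts by (simp add: twisted_sum_def)
  define s where "s = inv_into (pts X) q"
  have s: "s (q x) \<in> pts X" "q (s (q x)) = q x" if "x \<in> pts X" for x
    using that by (auto simp: s_def inv_into_into f_inv_into_f)
  define d where "d x = vadd X x (vscale X (-1) (s (q x)))" for x
  have d: "d x \<in> i ` pts Z" if "x \<in> pts X" for x
    unfolding ker using that s[of x] q X.add_closed X.scale_closed
    by (auto simp: d_def Y.add_minus)
  define h where "h x = (inv_into (pts Z) i (d x), q x)" for x
  have "inj_on h (pts X)"
  proof (rule inj_onI)
    fix x y assume xy: "x \<in> pts X" "y \<in> pts X" and eq: "h x = h y"
    then have "q x = q y" and "d x = d y"
      using d inv_into_injective[of "pts Z" i "d x" "d y"] by (auto simp: h_def)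
    then show "x = y"
      using X.add_right_cancel[of x y "vscale X (-1) (s (q x))"] xy s X.scale_closed
      by (simp add: d_def)
  qed
  then obtain X' :: "('z \<times> 'y) nspace" and i' q'
    where "twisted_sum Z Y X' i' q'" "splits Z X' i' \<longleftrightarrow> splits Z X i"
    by (rule transport_twisted_sum[OF ts])
  with ns show ?thesis
    unfolding nontrivial_twisted_sum_exists_def by (intro exI conjI) simp_all
qed

section \<open>The spaces \<open>c\<^sub>0\<close> and \<open>C(K)\<close>\<close>

definition c0_space :: "(nat \<Rightarrow> real) nspace" where
  "c0_space = \<lparr>pts = {x. x \<longlonglongrightarrow> 0}, vadd = \<lambda>x y n. x n + y n, vzero = \<lambda>n. 0,
     vscale = \<lambda>a x n. a * x n, vnorm = \<lambda>x. SUP n. \<bar>x n\<bar>\<rparr>"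

text \<open>On a compact space every continuous function is bounded, so \<open>C(K)\<close> is the type of bounded
  continuous functions with the supremum norm. Its completeness is an instance in the library only
  over metric domains, hence the lemma below.\<close>

abbreviation CK_space :: "'a::topological_space itself \<Rightarrow> ('a \<Rightarrow>\<^sub>C real) nspace" where
  "CK_space _ \<equiv> nspace_of TYPE('a \<Rightarrow>\<^sub>C real)"

lemma continuous_imp_bcontfun:
  fixes f :: "'a::topological_space \<Rightarrow> real"
  assumes "compact (UNIV :: 'a set)" "continuous_on UNIV f"
  shows "f \<in> bcontfun"
  using assms compact_imp_bounded[OF compact_continuous_image[OF assms(2,1)]]
  by (simp add: bcontfun_def)

lemma normed_space_on_nspace_of: "normed_space_on (nspace_of TYPE('b::real_normed_vector))"
proof
  fix x :: 'b
  show "\<exists>y\<in>pts (nspace_of TYPE('b)). vadd (nspace_of TYPE('b)) x y = vzero (nspace_of TYPE('b))"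
    by (auto simp: nspace_of_def intro: exI[of _ "-x"])
qed (auto simp: nspace_of_def algebra_simps norm_triangle_ineq)

lemma bcontfun_Cauchy_convergent:
  fixes f :: "nat \<Rightarrow> ('a::topological_space \<Rightarrow>\<^sub>C 'b::complete_space)"
  assumes "Cauchy f"
  shows "convergent f"
proof -
  obtain g where "uniform_limit UNIV (\<lambda>n. apply_bcontfun (f n)) g sequentially"
    using assms uniformly_convergent_eq_cauchy[of "\<lambda>_. True" "\<lambda>n. apply_bcontfun (f n)"]
    unfolding Cauchy_def uniform_limit_sequentially_iff
    by (metis dist_fun_lt_imp_dist_val_lt)
  from uniform_limit_bcontfunE[OF this sequentially_bot] show ?thesis
    by (metis convergentI)
qed

lemma banach_CK_space: "banach_space_on (CK_space TYPE('a::topological_space))"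
proof (rule banach_space_on.intro[OF normed_space_on_nspace_of], unfold_locales)
  fix s :: "nat \<Rightarrow> ('a \<Rightarrow>\<^sub>C real)"
  have d: "vdist (CK_space TYPE('a)) x y = dist x y" for x y
    by (simp add: vdist_def nspace_of_def dist_norm)
  assume "\<forall>e>0. \<exists>N. \<forall>m\<ge>N. \<forall>n\<ge>N. vdist (CK_space TYPE('a)) (s m) (s n) < e"
  then have "Cauchy s"
    by (simp add: d Cauchy_def)
  then have "convergent s"
    by (rule bcontfun_Cauchy_convergent)
  then obtain l where "s \<longlonglongrightarrow> l"
    unfolding convergent_def ..
  then have "(\<lambda>n. dist (s n) l) \<longlonglongrightarrow> 0"
    by (simp add: tendsto_dist_iff[symmetric])
  then show "\<exists>l\<in>pts (CK_space TYPE('a)). (\<lambda>n. vdist (CK_space TYPE('a)) (s n) l) \<longlonglongrightarrow> 0"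
    unfolding d by (intro bexI[of _ l]) (simp_all add: nspace_of_def)
qed

lemma c0_norm_bdd: "x \<in> pts c0_space \<Longrightarrow> bdd_above (range (\<lambda>n. \<bar>x n\<bar>))"
proof -
  assume "x \<in> pts c0_space"
  then have "(\<lambda>n. \<bar>x n\<bar>) \<longlonglongrightarrow> 0"
    by (simp add: c0_space_def tendsto_rabs_zero)
  then show ?thesis
    by (intro Bseq_bdd_above convergent_imp_Bseq convergentI)
qed

lemma c0_norm_upper: "x \<in> pts c0_space \<Longrightarrow> \<bar>x n\<bar> \<le> vnorm c0_space x"
  using cSUP_upper[OF UNIV_I c0_norm_bdd, of x n] by (simp add: c0_space_def)

lemma c0_norm_le: "(\<And>n. \<bar>x n\<bar> \<le> B) \<Longrightarrow> vnorm c0_space x \<le> B"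
  by (auto simp: c0_space_def intro: cSUP_least)

lemma normed_space_on_c0: "normed_space_on c0_space"
proof
  fix x y :: "nat \<Rightarrow> real" and a b :: real
  assume x: "x \<in> pts c0_space"
  have x0: "x \<longlonglongrightarrow> 0" using x by (simp add: c0_space_def)
  show sc: "vscale c0_space a x \<in> pts c0_space"
    using tendsto_mult_right_zero[OF x0, of a] by (simp add: c0_space_def)
  show "\<exists>y\<in>pts c0_space. vadd c0_space x y = vzero c0_space"
    using tendsto_minus[OF x0] by (intro bexI[of _ "\<lambda>n. - x n"]) (auto simp: c0_space_def)
  show "vnorm c0_space x = 0 \<longleftrightarrow> x = vzero c0_space"
    using c0_norm_upper[OF x] by (auto simp: c0_space_def)
  show "vnorm c0_space (vscale c0_space a x) = \<bar>a\<bar> * vnorm c0_space x"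
  proof (cases "a = 0")
    case True
    then show ?thesis by (simp add: c0_space_def)
  next
    case False
    have u: "\<bar>a\<bar> * \<bar>x n\<bar> \<le> vnorm c0_space (vscale c0_space a x)" for n
      using c0_norm_upper[OF sc, of n] by (simp add: c0_space_def abs_mult)
    have "vnorm c0_space x \<le> vnorm c0_space (vscale c0_space a x) / \<bar>a\<bar>"
      using u False by (intro c0_norm_le) (simp add: field_simps)
    moreover have "vnorm c0_space (vscale c0_space a x) \<le> \<bar>a\<bar> * vnorm c0_space x"
    proof (rule c0_norm_le)
      fix n
      show "\<bar>vscale c0_space a x n\<bar> \<le> \<bar>a\<bar> * vnorm c0_space x"
        using mult_left_mono[OF c0_norm_upper[OF x, of n], of "\<bar>a\<bar>"]
        by (simp add: c0_space_def abs_mult)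
    qed
    ultimately show ?thesis
      using False by (simp add: field_simps)
  qed
  assume y: "y \<in> pts c0_space"
  then show "vadd c0_space x y \<in> pts c0_space"
    using tendsto_add[OF x0, of y 0] by (simp add: c0_space_def)
  show "vnorm c0_space (vadd c0_space x y) \<le> vnorm c0_space x + vnorm c0_space y"
  proof (rule c0_norm_le)
    fix n
    have "\<bar>x n + y n\<bar> \<le> vnorm c0_space x + vnorm c0_space y"
      using c0_norm_upper[OF x, of n] c0_norm_upper[OF y, of n] by linarith
    then show "\<bar>vadd c0_space x y n\<bar> \<le> vnorm c0_space x + vnorm c0_space y"
      by (simp add: c0_space_def)
  qed
qed (auto simp: c0_space_def algebra_simps)

lemma banach_c0_space: "banach_space_on c0_space"
proof (rule banach_space_on.intro[OF normed_space_on_c0], unfold_locales)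
  interpret normed_space_on c0_space by (rule normed_space_on_c0)
  fix s :: "nat \<Rightarrow> nat \<Rightarrow> real"
  assume s: "range s \<subseteq> pts c0_space"
    and C: "\<forall>e>0. \<exists>N. \<forall>m\<ge>N. \<forall>n\<ge>N. vdist c0_space (s m) (s n) < e"
  have s0: "s m \<longlonglongrightarrow> 0" for m
    using s by (auto simp: c0_space_def)
  have sm: "s m \<in> pts c0_space" for m
    using s by blast
  have dle: "\<bar>x k - y k\<bar> \<le> vdist c0_space x y" if "x \<in> pts c0_space" "y \<in> pts c0_space" for x y k
    using c0_norm_upper[OF add_closed[OF that(1) scale_closed[OF that(2)]], of "-1" k]
    by (simp add: vdist_def c0_space_def)
  have "uniformly_convergent_on UNIV s"
    unfolding uniformly_convergent_eq_Cauchy uniformly_Cauchy_on_def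
  proof (intro allI impI)
    fix e :: real assume "e > 0"
    then obtain N where "\<forall>m\<ge>N. \<forall>n\<ge>N. vdist c0_space (s m) (s n) < e"
      using C by blast
    then show "\<exists>M. \<forall>x\<in>UNIV. \<forall>m\<ge>M. \<forall>n\<ge>M. dist (s m x) (s n x) < e"
      using dle sm unfolding dist_real_def by (meson le_less_trans)
  qed
  then obtain l where l: "uniform_limit UNIV s l sequentially"
    by (auto simp: uniformly_convergent_on_def)
  have "l \<longlonglongrightarrow> 0"
    by (rule swap_uniform_limit'[OF _ tendsto_const l]) (use s0 in \<open>auto intro: always_eventually\<close>)
  then have lc: "l \<in> pts c0_space"
    by (simp add: c0_space_def)
  have "(\<lambda>n. vdist c0_space (s n) l) \<longlonglongrightarrow> 0"
  proof (rule tendstoI)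
    fix e :: real assume e: "e > 0"
    from uniform_limitD[OF l, of "e/2"] e
    have "\<forall>\<^sub>F n in sequentially. \<forall>k. \<bar>s n k - l k\<bar> < e/2"
      by (simp add: dist_real_def)
    then show "\<forall>\<^sub>F n in sequentially. dist (vdist c0_space (s n) l) 0 < e"
    proof eventually_elim
      case (elim n)
      have "vdist c0_space (s n) l \<le> e/2"
        unfolding vdist_def
        by (rule c0_norm_le) (use elim in \<open>auto simp: c0_space_def intro: less_imp_le\<close>)
      moreover have "0 \<le> vdist c0_space (s n) l"
        using dle[OF sm[of n] lc, of 0] by linarith
      ultimately show ?case using e by simp
    qed
  qed
  with lc show "\<exists>l\<in>pts c0_space. (\<lambda>n. vdist c0_space (s n) l) \<longlonglongrightarrow> 0" by blast
qed

end

theory Submission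
  imports Defs
begin

text \<open>
  A twisted sum of \<open>c\<^sub>0\<close> and \<open>Y\<close> can be built from a bounded operator from \<open>Y\<close> to the quotient
  \<open>\<ell>\<^sub>\<infinity> / c\<^sub>0\<close>, as the pullback of \<open>0 \<rightarrow> c\<^sub>0 \<rightarrow> \<ell>\<^sub>\<infinity> \<rightarrow> \<ell>\<^sub>\<infinity> / c\<^sub>0 \<rightarrow> 0\<close>, and it splits exactly when
  the operator lifts to \<open>\<ell>\<^sub>\<infinity>\<close>, that is, when some sequence of bounded functionals \<open>\<psi>\<^sub>n\<close> satisfies
  \<open>t f n - \<psi>\<^sub>n f \<rightarrow> 0\<close> for all \<open>f\<close>. Here the operator is represented by a map \<open>t\<close> into bounded
  sequences that is linear up to null sequences (\<open>nontrivial_twisted_sum_of_almost_linear\<close>). So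
  the task is to find such a \<open>t\<close> on \<open>C(K)\<close> that no sequence of functionals lifts. There are two
  cases, according to the size of \<open>K\<close>.

  If \<open>K\<close> has more than continuum many points, it contains a strictly monotone \<open>\<omega>\<^sub>1\<close>-sequence: the
  search path of a point through a binary search tree is coded by a countable set of reals unless
  it has uncountable length (\<open>lepoll_continuum_or_chain\<close>). The differences of \<open>f\<close> at consecutive
  members of the chain form an element of \<open>c\<^sub>0(\<omega>\<^sub>1)\<close>, which is spread along an almost disjoint family
  of sets of naturals, as in the construction of the Johnson-Lindenstrauss spaces. Any countable
  set of functionals annihilates one of uncountably many bumps with bounded overlaps, and such
  a bump contradicts a lift.

  If \<open>K\<close> has at most continuum many points, then so have \<open>C(K)\<close> and its dual. For the dual, every
  functional has small variation on the gaps of suitable finite partitions, and so it is the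
  pointwise limit of a sequence of finite combinations of point evaluations
  (\<open>functional_limit_of_molecules\<close>). Hence, under the continuum hypothesis, both the functions and
  the candidates for a lift can be enumerated in type \<open>\<omega>\<^sub>1\<close>. The values \<open>t y\<^sub>\<alpha>\<close> are defined by
  recursion, keeping the following invariant: on countably many \<open>f\<close>, up to null sequences, \<open>t f\<close> is
  \<open>f(p\<^sub>n) - f(q\<^sub>n)\<close> for points \<open>p\<^sub>n, q\<^sub>n\<close> of \<open>K\<close> that coincide infinitely often. Since \<open>K\<close> is not
  metrizable, uncountably often \<open>y\<^sub>\<alpha>\<close> separates two points that no earlier function separates.
  Substituting these points for infinitely many of the coinciding pairs leaves the earlier values
  intact and changes \<open>t y\<^sub>\<alpha>\<close>, so one of the two choices defeats the \<open>\<alpha>\<close>-th candidate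
  (\<open>tracked_insert\<close>).
\<close>

section \<open>Sets of the size of the continuum\<close>

text \<open>Under the continuum hypothesis the reals can serve as an index set of type \<open>\<omega>\<^sub>1\<close> for transfinite
recursions whose stages have countably many predecessors.\<close>

lemma CH_wellorder:
  assumes "continuum_hypothesis"
  obtains r :: "real rel" where "wf r" "trans r" "\<And>x y. x \<noteq> y \<Longrightarrow> (x, y) \<in> r \<or> (y, x) \<in> r"
    "\<And>x. countable {y. (y, x) \<in> r}"
proof -
  include cardinal_syntax
  define R where "R = |UNIV :: real set|"
  have co: "card_order R" "Card_order R" "Field R = UNIV"
    unfolding R_def by (simp_all add: card_of_card_order_on card_of_Card_order Field_card_of)
  have wo: "well_order R" "Well_order R"
    using co by (simp_all add: card_order_on_def)
  have lin: "Linear_order R" "linear_order R"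
    using wo co(3) by (simp_all add: well_order_on_def)
  show thesis
  proof (rule that[of "R - Id"])
    show "wf (R - Id)" using wo by (simp add: well_order_on_def)
    show "trans (R - Id)"
      using lin by (simp add: linear_order_on_def partial_order_on_def preorder_on_def trans_diff_Id)
    show "(x, y) \<in> R - Id \<or> (y, x) \<in> R - Id" if "x \<noteq> y" for x y
      using lin(2) that by (auto simp: linear_order_on_def total_on_def)
    show "countable {y. (y, x) \<in> R - Id}" for x
    proof -
      have eq: "{y. (y, x) \<in> R - Id} = underS R x" by (auto simp: underS_def)
      have "|underS R x| <o R" using co by (intro card_of_underS) auto
      moreover have "R =o cardSuc natLeq"
        using assms by (simp add: R_def continuum_hypothesis_def)
      ultimately have "|underS R x| <o cardSuc natLeq" by (rule ordLess_ordIso_trans)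
      then have "|underS R x| \<le>o natLeq"
        using cardSuc_ordLeq_ordLess[OF natLeq_Card_order card_of_Card_order] by blast
      then have "|underS R x| \<le>o |UNIV :: nat set|"
        by (rule ordLeq_ordIso_trans[OF _ ordIso_symmetric[OF card_of_nat]])
      then show ?thesis
        unfolding eq countable_def by (auto simp: card_of_ordLeq[symmetric])
    qed
  qed
qed

lemma CH_uncountable:
  assumes "continuum_hypothesis" "uncountable A"
  shows "(UNIV :: real set) \<lesssim> A"
proof -
  include cardinal_syntax
  have "\<not> |A| \<le>o natLeq"
  proof
    assume "|A| \<le>o natLeq"
    then have "|A| \<le>o |UNIV :: nat set|"
      by (rule ordLeq_ordIso_trans[OF _ ordIso_symmetric[OF card_of_nat]])
    then show False using assms(2) by (auto simp: countable_def card_of_ordLeq[symmetric])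
  qed
  then have "natLeq <o |A|"
    using not_ordLeq_iff_ordLess[OF natLeq_Well_order card_of_Well_order] by blast
  then have "cardSuc natLeq \<le>o |A|"
    by (intro cardSuc_least natLeq_Card_order card_of_Card_order)
  then have "|UNIV :: real set| \<le>o |A|"
    using assms(1) ordIso_ordLeq_trans by (auto simp: continuum_hypothesis_def)
  then show ?thesis by (simp add: lepoll_def card_of_ordLeq[symmetric])
qed

lemma lepoll_real_seq:
  assumes "A \<lesssim> (UNIV :: real set)"
  shows "{s :: nat \<Rightarrow> 'x. range s \<subseteq> A} \<lesssim> (UNIV :: real set)"
proof -
  have "A \<lesssim> (UNIV :: nat set set)"
    using assms nat_sets_eqpoll_reals by (meson eqpoll_sym lepoll_trans2)
  then obtain f :: "'x \<Rightarrow> nat set" where f: "inj_on f A" by (auto simp: lepoll_def)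
  define g where "g s = {prod_encode (n, k) | n k. k \<in> f (s n)}" for s :: "nat \<Rightarrow> 'x"
  have g: "k \<in> f (s n) \<longleftrightarrow> prod_encode (n, k) \<in> g s" for s n k
    by (auto simp: g_def)
  have "inj_on g {s. range s \<subseteq> A}"
  proof (rule inj_onI)
    fix s t assume st: "s \<in> {s. range s \<subseteq> A}" "t \<in> {s. range s \<subseteq> A}" "g s = g t"
    have "f (s n) = f (t n)" for n
      using g[of _ s n] g[of _ t n] st(3) by blast
    then have "s n = t n" for n
      using st(1,2) inj_onD[OF f, of "s n" "t n"] by blast
    then show "s = t" ..
  qed
  then have "{s :: nat \<Rightarrow> 'x. range s \<subseteq> A} \<lesssim> (UNIV :: nat set set)"
    by (auto simp: lepoll_def)
  then show ?thesis using nat_sets_eqpoll_reals lepoll_trans2 by blast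
qed

lemma lepoll_real_Times:
  assumes "A \<lesssim> (UNIV :: real set)" "B \<lesssim> (UNIV :: real set)"
  shows "A \<times> B \<lesssim> (UNIV :: real set)"
proof -
  have "A \<times> B \<lesssim> (UNIV :: real set) \<times> (UNIV :: real set)"
    using assms by (rule times_lepoll_mono)
  also have "\<dots> \<lesssim> {s :: nat \<Rightarrow> real. range s \<subseteq> UNIV}"
  proof (rule subset_image_lepoll[of _ "\<lambda>s. (s 0, s 1)"], rule subsetI)
    fix p :: "real \<times> real"
    show "p \<in> (\<lambda>s. (s 0, s 1)) ` {s :: nat \<Rightarrow> real. range s \<subseteq> UNIV}"
      by (rule image_eqI[of _ _ "\<lambda>n. if n = 0 then fst p else snd p"]) auto
  qed
  also have "\<dots> \<lesssim> (UNIV :: real set)"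
    by (rule lepoll_real_seq) simp
  finally show ?thesis .
qed

lemma lepoll_real_countable_subsets:
  "{S :: real set. countable S} \<lesssim> (UNIV :: real set)"
proof -
  have "{S :: real set. countable S} \<subseteq> (\<lambda>(s :: nat \<Rightarrow> real, S). range s \<inter> S) ` (UNIV \<times> {{}, UNIV})"
  proof
    fix S :: "real set" assume "S \<in> {S. countable S}"
    then have S: "countable S" by simp
    show "S \<in> (\<lambda>(s :: nat \<Rightarrow> real, S). range s \<inter> S) ` (UNIV \<times> {{}, UNIV})"
    proof (cases "S = {}")
      case True
      then show ?thesis by (intro image_eqI[of _ _ "(\<lambda>_. 0, {})"]) auto
    next
      case False
      then obtain s :: "nat \<Rightarrow> real" where "S = range s"
        using S uncountable_def by metis
      then show ?thesis by (intro image_eqI[of _ _ "(s, UNIV)"]) auto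
    qed
  qed
  then have "{S :: real set. countable S} \<lesssim> (UNIV :: (nat \<Rightarrow> real) set) \<times> {{}, UNIV :: real set}"
    by (rule subset_image_lepoll)
  also have "\<dots> \<lesssim> (UNIV :: real set)"
  proof (rule lepoll_real_Times)
    show "(UNIV :: (nat \<Rightarrow> real) set) \<lesssim> (UNIV :: real set)"
      using lepoll_real_seq[of "UNIV :: real set"] by simp
    show "{{}, UNIV :: real set} \<lesssim> (UNIV :: real set)"
      by (intro finite_lepoll_infinite infinite_UNIV_char_0) auto
  qed
  finally show ?thesis .
qed

section \<open>Linear orders without uncountable monotone chains\<close>

text \<open>Points are inserted into a binary search tree. A set \<open>S\<close> of reals prescribes at which stages to turn
right, and \<open>path S \<alpha>\<close> is the node met at stage \<open>\<alpha>\<close>; it depends only on \<open>S\<close> below \<open>\<alpha>\<close>, a countable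
set. So nodes are coded by pairs of a countable set and a real, and if the order is too big, some
point \<open>x\<close> is never met. The search for \<open>x\<close> then runs through all stages. The nodes at which it
turns right increase and the nodes at which it turns left decrease, and there are uncountably many
of one kind.\<close>

lemma lepoll_continuum_or_chain:
  fixes r :: "real rel"
  assumes r: "wf r" "trans r" "\<And>x. countable {y. (y, x) \<in> r}"
  assumes big: "\<not> (UNIV :: 'a :: linorder set) \<lesssim> (UNIV :: real set)"
  obtains E and c :: "real \<Rightarrow> 'a :: linorder" where "uncountable E"
    "(\<forall>\<alpha>\<in>E. \<forall>\<beta>\<in>E. (\<alpha>, \<beta>) \<in> r \<longrightarrow> c \<alpha> < c \<beta>) \<or> (\<forall>\<alpha>\<in>E. \<forall>\<beta>\<in>E. (\<alpha>, \<beta>) \<in> r \<longrightarrow> c \<beta> < c \<alpha>)"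
proof -
  define F where "F S c \<alpha> = (SOME z :: 'a. \<forall>\<beta>. (\<beta>, \<alpha>) \<in> r \<longrightarrow> (if \<beta> \<in> S then c \<beta> < z else z < c \<beta>))"
    for S c \<alpha>
  have F_cong: "F S c \<alpha> = F S' c' \<alpha>"
    if "\<And>\<beta>. (\<beta>, \<alpha>) \<in> r \<Longrightarrow> c \<beta> = c' \<beta> \<and> (\<beta> \<in> S \<longleftrightarrow> \<beta> \<in> S')" for S S' c c' \<alpha>
    unfolding F_def by (rule arg_cong[of _ _ Eps]) (use that in fastforce)
  define path where "path S = wfrec r (F S)" for S
  have path: "path S \<alpha> = F S (path S) \<alpha>" for S \<alpha>
  proof -
    have "path S \<alpha> = F S (cut (path S) r \<alpha>) \<alpha>"
      unfolding path_def by (subst wfrec[OF r(1)]) simp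
    also have "\<dots> = F S (path S) \<alpha>"
      by (rule F_cong) (simp add: cut_apply)
    finally show ?thesis .
  qed
  have path_cong: "path S \<alpha> = path S' \<alpha>"
    if "\<And>\<beta>. (\<beta>, \<alpha>) \<in> r \<Longrightarrow> \<beta> \<in> S \<longleftrightarrow> \<beta> \<in> S'" for S S' \<alpha>
    using that
  proof (induction \<alpha> rule: wf_induct_rule[OF r(1)])
    case (1 \<alpha>)
    then show ?case
      by (subst (1 2) path, intro F_cong) (use r(2) in \<open>blast dest: transD\<close>)
  qed
  have "\<exists>x. \<forall>S \<alpha>. countable S \<longrightarrow> path S \<alpha> \<noteq> x"
  proof (rule ccontr)
    assume "\<not> ?thesis"
    then have ex: "\<exists>S \<alpha>. countable S \<and> path S \<alpha> = x" for x by blast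
    have "(UNIV :: 'a set) \<subseteq> (\<lambda>(S, \<alpha>). path S \<alpha>) ` ({S. countable S} \<times> UNIV)"
    proof
      fix x :: 'a
      obtain S \<alpha> where "countable S" "path S \<alpha> = x" using ex by blast
      then show "x \<in> (\<lambda>(S, \<alpha>). path S \<alpha>) ` ({S. countable S} \<times> UNIV)"
        by (intro image_eqI[of _ _ "(S, \<alpha>)"]) auto
    qed
    then have "(UNIV :: 'a set) \<lesssim> {S :: real set. countable S} \<times> (UNIV :: real set)"
      by (rule subset_image_lepoll)
    also have "\<dots> \<lesssim> (UNIV :: real set)"
      by (intro lepoll_real_Times lepoll_real_countable_subsets) auto
    finally show False using big by simp
  qed
  then obtain x where x: "\<And>S \<alpha>. countable S \<Longrightarrow> path S \<alpha> \<noteq> x" by blast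
  \<comment> \<open>the search for \<open>x\<close>, which determines its own set of right turns\<close>
  define c where "c = wfrec r (\<lambda>c. F {\<beta>. c \<beta> < x} c)"
  define S where "S = {\<beta>. c \<beta> < x}"
  have c: "c \<alpha> = F S c \<alpha>" for \<alpha>
  proof -
    have "c \<alpha> = F {\<beta>. cut c r \<alpha> \<beta> < x} (cut c r \<alpha>) \<alpha>"
      unfolding c_def by (subst wfrec[OF r(1)]) simp
    also have "\<dots> = F S c \<alpha>"
      by (rule F_cong) (simp add: cut_apply S_def)
    finally show ?thesis .
  qed
  have "c \<alpha> = path S \<alpha>" for \<alpha>
  proof (induction \<alpha> rule: wf_induct_rule[OF r(1)])
    case (1 \<alpha>)
    then show ?case by (subst c, subst path, intro F_cong) blast
  qed
  moreover have "path S \<alpha> = path (S \<inter> {\<beta>. (\<beta>, \<alpha>) \<in> r}) \<alpha>" for \<alpha>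
    by (rule path_cong) blast
  moreover have "countable (S \<inter> {\<beta>. (\<beta>, \<alpha>) \<in> r})" for \<alpha>
    using r(3) by blast
  ultimately have cx: "c \<alpha> \<noteq> x" for \<alpha> using x by metis
  have sep: "if \<beta> \<in> S then c \<beta> < c \<alpha> else c \<alpha> < c \<beta>" if "(\<beta>, \<alpha>) \<in> r" for \<alpha> \<beta>
  proof -
    have "\<forall>\<beta>. (\<beta>, \<alpha>) \<in> r \<longrightarrow> (if \<beta> \<in> S then c \<beta> < x else x < c \<beta>)"
      using cx by (auto simp: S_def not_less_iff_gr_or_eq)
    then have "\<forall>\<beta>. (\<beta>, \<alpha>) \<in> r \<longrightarrow> (if \<beta> \<in> S then c \<beta> < F S c \<alpha> else F S c \<alpha> < c \<beta>)"
      unfolding F_def by (rule someI)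
    then show ?thesis using that unfolding c[of \<alpha>, symmetric] by blast
  qed
  have "uncountable S \<or> uncountable (- S)"
    using uncountable_UNIV_real countable_Un[of S "- S"] by auto
  then show thesis
  proof
    assume "uncountable S"
    moreover have "\<forall>\<alpha>\<in>S. \<forall>\<beta>\<in>S. (\<alpha>, \<beta>) \<in> r \<longrightarrow> c \<alpha> < c \<beta>"
      using sep by (metis (full_types))
    ultimately show thesis using that by blast
  next
    assume "uncountable (- S)"
    moreover have "\<forall>\<alpha>\<in>- S. \<forall>\<beta>\<in>- S. (\<alpha>, \<beta>) \<in> r \<longrightarrow> c \<beta> < c \<alpha>"
      using sep by (metis (full_types) ComplD)
    ultimately show thesis using that by blast
  qed
qed

section \<open>Twisted sums from almost linear maps\<close>

lemma normed_space_on_subspace: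
  fixes V :: "'b::real_normed_vector set"
  assumes "subspace V"
  shows "normed_space_on (nspace_of TYPE('b)\<lparr>pts := V\<rparr>)"
proof
  fix x assume "x \<in> pts (nspace_of TYPE('b)\<lparr>pts := V\<rparr>)"
  then show "\<exists>y\<in>pts (nspace_of TYPE('b)\<lparr>pts := V\<rparr>).
      vadd (nspace_of TYPE('b)\<lparr>pts := V\<rparr>) x y = vzero (nspace_of TYPE('b)\<lparr>pts := V\<rparr>)"
    using assms by (intro bexI[of _ "- x"]) (auto simp: nspace_of_def subspace_neg)
qed (use assms in \<open>auto simp: nspace_of_def algebra_simps norm_triangle_ineq subspace_0
      subspace_add subspace_scale\<close>)

lemma banach_space_on_closed_subspace:
  fixes V :: "'b::real_normed_vector set"
  assumes "subspace V" "closed V" and conv: "\<And>s :: nat \<Rightarrow> 'b. Cauchy s \<Longrightarrow> convergent s"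
  shows "banach_space_on (nspace_of TYPE('b)\<lparr>pts := V\<rparr>)"
proof (rule banach_space_on.intro[OF normed_space_on_subspace[OF assms(1)]], unfold_locales)
  let ?X = "nspace_of TYPE('b)\<lparr>pts := V\<rparr>"
  have d: "vdist ?X x y = dist x y" for x y
    by (simp add: vdist_def nspace_of_def dist_norm)
  fix s :: "nat \<Rightarrow> 'b"
  assume V: "range s \<subseteq> pts ?X" and "\<forall>e>0. \<exists>N. \<forall>m\<ge>N. \<forall>n\<ge>N. vdist ?X (s m) (s n) < e"
  then have "Cauchy s" by (simp add: d Cauchy_def)
  then obtain l where l: "s \<longlonglongrightarrow> l" using conv by (auto simp: convergent_def)
  have "l \<in> V"
    by (rule closed_sequentially[OF assms(2) _ l]) (use V in \<open>auto simp: nspace_of_def\<close>)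
  with l show "\<exists>l\<in>pts ?X. (\<lambda>n. vdist ?X (s n) l) \<longlonglongrightarrow> 0"
    unfolding d by (intro bexI[of _ l]) (simp_all add: nspace_of_def tendsto_dist_iff[symmetric])
qed

lemma bcontfun_nat: "bounded (range s) \<Longrightarrow> (s :: nat \<Rightarrow> real) \<in> bcontfun"
  by (simp add: bcontfun_def)

text \<open>The map \<open>t\<close> induces an operator to \<open>\<ell>\<^sub>\<infinity> / c\<^sub>0\<close>, and the middle space is the pullback: the pairs
\<open>(f, u)\<close> with \<open>u - t f\<close> a null sequence. It is closed because the operator is bounded. A bounded left
inverse \<open>R\<close> of the inclusion of \<open>c\<^sub>0\<close> gives the lift \<open>f \<mapsto> t f - R (f, t f)\<close>, which is linear because
\<open>u - R (f, u)\<close> is the same for all \<open>u\<close> with \<open>(f, u)\<close> in the space.\<close>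

theorem nontrivial_twisted_sum_of_almost_linear:
  fixes t :: "'b::real_normed_vector \<Rightarrow> nat \<Rightarrow> real"
  assumes conv: "\<And>s :: nat \<Rightarrow> 'b. Cauchy s \<Longrightarrow> convergent s"
    and add: "\<And>f g. (\<lambda>n. t (f + g) n - (t f n + t g n)) \<longlonglongrightarrow> 0"
    and scale: "\<And>a f. (\<lambda>n. t (a *\<^sub>R f) n - a * t f n) \<longlonglongrightarrow> 0"
    and bound: "\<And>f n. \<bar>t f n\<bar> \<le> C * norm f"
    and no_lift: "\<And>\<psi> :: nat \<Rightarrow> 'b \<Rightarrow> real. (\<And>n. bounded_linear (\<psi> n)) \<Longrightarrow>
                    \<exists>f. \<not> (\<lambda>n. t f n - \<psi> n f) \<longlonglongrightarrow> 0"
  shows "nontrivial_twisted_sum_exists c0_space (nspace_of TYPE('b))"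
proof -
  define V where "V = {(f, u :: nat \<Rightarrow>\<^sub>C real). (\<lambda>n. u n - t f n) \<longlonglongrightarrow> 0}"
  define T where "T f = Bcontfun (t f)" for f
  have T: "apply_bcontfun (T f) = t f" for f
    unfolding T_def
    by (rule Bcontfun_inverse, rule bcontfun_nat) (use bound in \<open>auto simp: bounded_iff\<close>)
  define J where "J z = Bcontfun z" for z :: "nat \<Rightarrow> real"
  have J: "apply_bcontfun (J z) = z" if "z \<longlonglongrightarrow> 0" for z
    unfolding J_def
    by (rule Bcontfun_inverse, rule bcontfun_nat) (use that convergent_imp_bounded in blast)
  have VT: "(f, T f) \<in> V" for f by (simp add: V_def T)
  have VJ: "(0, J z) \<in> V" if "z \<longlonglongrightarrow> 0" for z
  proof -
    have "(\<lambda>n. t 0 n) \<longlonglongrightarrow> 0" using scale[of 0 0] by simp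
    from tendsto_diff[OF that this] that show ?thesis by (simp add: V_def J)
  qed
  have kerV: "apply_bcontfun u \<longlonglongrightarrow> 0" if "(0, u) \<in> V" for u
  proof -
    have "(\<lambda>n. t 0 n) \<longlonglongrightarrow> 0" using scale[of 0 0] by simp
    moreover have "(\<lambda>n. u n - t 0 n) \<longlonglongrightarrow> 0" using that by (simp add: V_def)
    ultimately have "(\<lambda>n. (u n - t 0 n) + t 0 n) \<longlonglongrightarrow> 0 + 0" by (rule tendsto_add[rotated])
    then show ?thesis by simp
  qed
  have sub: "subspace V"
  proof (rule subspaceI)
    show "0 \<in> V"
      using VJ[OF tendsto_const] by (simp add: zero_prod_def J_def zero_bcontfun_def)
    fix x y assume xy: "x \<in> V" "y \<in> V"
    obtain f u g v where [simp]: "x = (f, u)" "y = (g, v)" by fastforce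
    have "(\<lambda>n. (u n - t f n) + (v n - t g n) - (t (f + g) n - (t f n + t g n))) \<longlonglongrightarrow> 0 + 0 - 0"
      using xy add by (intro tendsto_intros) (auto simp: V_def)
    then show "x + y \<in> V" by (simp add: V_def algebra_simps plus_bcontfun.rep_eq)
  next
    fix a x assume x: "x \<in> V"
    obtain f u where [simp]: "x = (f, u)" by fastforce
    have "(\<lambda>n. a * (u n - t f n) - (t (a *\<^sub>R f) n - a * t f n)) \<longlonglongrightarrow> a * 0 - 0"
      using x scale by (intro tendsto_intros) (auto simp: V_def)
    then show "a *\<^sub>R x \<in> V" by (simp add: V_def algebra_simps scaleR_bcontfun.rep_eq)
  qed
  \<comment> \<open>the induced operator is bounded, although \<open>t\<close> itself need not be continuous\<close>
  have tdiff: "\<forall>\<^sub>F n in sequentially. \<bar>t f n - t g n\<bar> \<le> C * norm (f - g) + e" if "e > 0" for f g e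
  proof -
    have "\<forall>\<^sub>F n in sequentially. \<bar>t (f - g + g) n - (t (f - g) n + t g n)\<bar> < e"
      using tendstoD[OF add[of "f - g" g] that] by simp
    then show ?thesis
    proof eventually_elim
      case (elim n)
      have "\<bar>t (f - g) n\<bar> \<le> C * norm (f - g)" by (rule bound)
      with elim show ?case by simp
    qed
  qed
  have cl: "closed V"
  proof (rule closed_sequential_limits[THEN iffD2])
    show "\<forall>x l. (\<forall>n. x n \<in> V) \<and> x \<longlonglongrightarrow> l \<longrightarrow> l \<in> V"
    proof (intro allI impI, elim conjE)
      fix s :: "nat \<Rightarrow> 'b \<times> (nat \<Rightarrow>\<^sub>C real)" and l
      assume s: "\<forall>n. s n \<in> V" "s \<longlonglongrightarrow> l"
      obtain f u where l: "l = (f, u)" by fastforce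
      have "(\<lambda>n. u n - t f n) \<longlonglongrightarrow> 0"
      proof (rule tendstoI)
        fix e :: real assume e: "e > 0"
        define d where "d = e / 4 / (\<bar>C\<bar> + 1)"
        have "\<bar>C\<bar> + 1 > 0" by linarith
        then have d0: "d > 0" and "(\<bar>C\<bar> + 1) * d = e / 4"
          using e nonzero_mult_div_cancel_left[of "\<bar>C\<bar> + 1" "e / 4"]
          unfolding d_def by (simp, metis less_irrefl times_divide_eq_right)
        then have "\<bar>C\<bar> * d + d = e / 4" "\<bar>C\<bar> * d \<ge> 0" by (simp_all add: algebra_simps)
        with d0 have d: "d > 0" "\<bar>C\<bar> * d \<le> e / 4" "d \<le> e / 4" by linarith+
        obtain k where k: "dist (s k) l < d"
          using tendstoD[OF s(2) d(1)] unfolding eventually_sequentially by blast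
        obtain g v where sk: "s k = (g, v)" by fastforce
        have dk: "norm (g - f) < d" "norm (v - u) < d"
          using k dist_fst_le[of "s k" l] dist_snd_le[of "s k" l] by (auto simp: l sk dist_norm)
        have vg: "(\<lambda>n. v n - t g n) \<longlonglongrightarrow> 0" using s(1)[rule_format, of k] by (simp add: sk V_def)
        have e4: "e / 4 > 0" using e by simp
        from tendstoD[OF vg e4] tdiff[OF e4, of g f]
        show "\<forall>\<^sub>F n in sequentially. dist (u n - t f n) 0 < e"
        proof eventually_elim
          case (elim n)
          have "\<bar>v n - u n\<bar> \<le> norm (v - u)"
            using norm_bounded[of "v - u" n] by (simp add: minus_bcontfun.rep_eq)
          moreover have "C * norm (g - f) \<le> \<bar>C\<bar> * d"
            using dk(1) by (intro mult_mono) auto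
          moreover have "\<bar>v n - t g n\<bar> < e / 4" using elim(1) by (simp add: dist_real_def)
          ultimately show ?case
            unfolding dist_real_def diff_0_right using elim(2) dk(2) d by linarith
        qed
      qed
      then show "l \<in> V" by (simp add: V_def l)
    qed
  qed
  have convX: "convergent s" if "Cauchy s" for s :: "nat \<Rightarrow> 'b \<times> (nat \<Rightarrow>\<^sub>C real)"
  proof -
    have "convergent (\<lambda>n. fst (s n))" "convergent (\<lambda>n. snd (s n))"
      using conv[OF Cauchy_fst[OF that]] bcontfun_Cauchy_convergent[OF Cauchy_snd[OF that]] by simp_all
    then obtain a b where "(\<lambda>n. fst (s n)) \<longlonglongrightarrow> a" "(\<lambda>n. snd (s n)) \<longlonglongrightarrow> b"
      by (auto simp: convergent_def)
    from tendsto_Pair[OF this] show ?thesis by (auto simp: convergent_def)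
  qed
  define X where "X = nspace_of TYPE('b \<times> (nat \<Rightarrow>\<^sub>C real))\<lparr>pts := V\<rparr>"
  have X: "pts X = V" "vadd X = (+)" "vzero X = 0" "vscale X = (*\<^sub>R)" "vnorm X = norm"
    by (simp_all add: X_def nspace_of_def)
  have Y: "pts (nspace_of TYPE('b)) = UNIV" "vadd (nspace_of TYPE('b)) = (+)"
     "vzero (nspace_of TYPE('b)) = 0" "vscale (nspace_of TYPE('b)) = (*\<^sub>R)"
     "vnorm (nspace_of TYPE('b)) = norm"
    by (simp_all add: nspace_of_def)
  have Z: "pts c0_space = {x. x \<longlonglongrightarrow> 0}" "vadd c0_space = (\<lambda>x y n. x n + y n)"
    "vscale c0_space = (\<lambda>a x n. a * x n)" by (simp_all add: c0_space_def)
  have banX: "banach_space_on X"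
    unfolding X_def by (rule banach_space_on_closed_subspace[OF sub cl convX])
  have banY: "banach_space_on (nspace_of TYPE('b))"
    using banach_space_on_closed_subspace[OF subspace_UNIV closed_UNIV conv]
    by (simp add: nspace_of_def)
  define i where "i z = (0 :: 'b, J z)" for z
  have iadd: "i (\<lambda>n. z n + w n) = i z + i w" if "z \<longlonglongrightarrow> 0" "w \<longlonglongrightarrow> 0" for z w
    using that tendsto_add[OF that]
    by (auto simp: i_def J plus_bcontfun.rep_eq intro!: bcontfun_eqI)
  have iscale: "i (\<lambda>n. a * z n) = a *\<^sub>R i z" if "z \<longlonglongrightarrow> 0" for z a
    using that tendsto_mult_right_zero[OF that, of a]
    by (auto simp: i_def J scaleR_bcontfun.rep_eq intro!: bcontfun_eqI)
  have inorm: "norm (i z) \<le> 1 * vnorm c0_space z" if "z \<longlonglongrightarrow> 0" for z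
  proof -
    have "norm (i z) = norm (J z)" by (simp add: i_def norm_Pair)
    also have "\<dots> \<le> vnorm c0_space z"
      using that by (intro norm_bound) (auto simp: J Z intro!: c0_norm_upper)
    finally show ?thesis by simp
  qed
  have bi: "bounded_linear_on c0_space X i"
    unfolding bounded_linear_on_def X Z
    using iadd iscale inorm VJ by (intro conjI exI[of _ 1]) (auto simp: i_def)
  have bq: "bounded_linear_on X (nspace_of TYPE('b)) fst"
    unfolding bounded_linear_on_def X Y
    by (auto intro!: exI[of _ 1] simp: norm_fst_le)
  have inj: "inj_on i (pts c0_space)"
  proof (rule inj_onI)
    fix z w assume zw: "z \<in> pts c0_space" "w \<in> pts c0_space" "i z = i w"
    then have "J z = J w" by (simp add: i_def)
    with zw show "z = w" using J[of z] J[of w] by (metis Z(1) mem_Collect_eq)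
  qed
  have ker: "i ` pts c0_space = {x \<in> pts X. fst x = vzero (nspace_of TYPE('b))}"
  proof (intro set_eqI iffI)
      fix x assume "x \<in> i ` pts c0_space"
      then show "x \<in> {x \<in> pts X. fst x = vzero (nspace_of TYPE('b))}"
        using VJ by (auto simp: X Y Z i_def)
  next
      fix x assume x: "x \<in> {x \<in> pts X. fst x = vzero (nspace_of TYPE('b))}"
      then obtain u where u: "x = (0, u)" "(0, u) \<in> V" by (cases x) (auto simp: X Y)
      have "x = i (apply_bcontfun u)"
        using kerV[OF u(2)] by (simp add: u(1) i_def J_def apply_bcontfun_inverse)
      with kerV[OF u(2)] show "x \<in> i ` pts c0_space" by (simp add: Z)
  qed
  have onto: "fst ` pts X = pts (nspace_of TYPE('b))"
  proof -
    have "f \<in> fst ` V" for f using imageI[OF VT[of f], of fst] by simp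
    then show ?thesis by (auto simp: X Y)
  qed
  have ts: "twisted_sum c0_space (nspace_of TYPE('b)) X i fst"
    by (simp only: twisted_sum_def banX banY bi bq banach_c0_space inj ker onto simp_thms)
  have "\<not> splits c0_space X i"
  proof
    assume "splits c0_space X i"
    then obtain R where R0: "bounded_linear_on X c0_space R" "\<forall>z\<in>pts c0_space. R (i z) = z"
      unfolding splits_def by blast
    obtain B where B: "\<forall>x\<in>V. vnorm c0_space (R x) \<le> B * norm x"
      using R0(1) unfolding bounded_linear_on_def X by blast
    have R: "\<And>x. x \<in> V \<Longrightarrow> R x \<longlonglongrightarrow> 0"
        "\<And>x y. x \<in> V \<Longrightarrow> y \<in> V \<Longrightarrow> R (x + y) = (\<lambda>n. R x n + R y n)"
        "\<And>a x. x \<in> V \<Longrightarrow> R (a *\<^sub>R x) = (\<lambda>n. a * R x n)"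
        "\<And>x. x \<in> V \<Longrightarrow> vnorm c0_space (R x) \<le> B * norm x"
        "\<And>z. z \<longlonglongrightarrow> 0 \<Longrightarrow> R (i z) = z"
      using R0 B unfolding bounded_linear_on_def X Z by blast+
    define \<psi> where "\<psi> n f = t f n - R (f, T f) n" for n f
    \<comment> \<open>any \<open>u\<close> that represents \<open>f\<close> gives the same value, whence linearity\<close>
    have indep: "u n - R (f, u) n = \<psi> n f" if fu: "(f, u) \<in> V" for f u n
    proof -
      define z where "z = (\<lambda>n. u n - t f n)"
      have z: "z \<longlonglongrightarrow> 0" using fu by (simp add: V_def z_def)
      have "(f, u) = (f, T f) + i z"
        using z by (auto simp: i_def T J plus_bcontfun.rep_eq z_def intro!: bcontfun_eqI)
      then have "R (f, u) = (\<lambda>n. R (f, T f) n + R (i z) n)"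
        using R(2)[OF VT, of "i z" f] VJ[OF z] z by (simp add: i_def del: add_Pair)
      then show ?thesis unfolding R(5)[OF z] by (simp add: \<psi>_def z_def)
    qed
    have "bounded_linear (\<psi> n)" for n
    proof (rule bounded_linear_intro)
      fix f g
      have "(f + g, T f + T g) \<in> V" using subspace_add[OF sub VT VT, of f g] by simp
      from indep[OF this, of n] R(2)[OF VT VT, of f g]
      show "\<psi> n (f + g) = \<psi> n f + \<psi> n g"
        by (simp add: \<psi>_def plus_bcontfun.rep_eq T)
    next
      fix a f
      have "(a *\<^sub>R f, a *\<^sub>R T f) \<in> V" using subspace_scale[OF sub VT, of a f] by simp
      from indep[OF this, of n] R(3)[OF VT, of a f]
      show "\<psi> n (a *\<^sub>R f) = a *\<^sub>R \<psi> n f"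
        by (simp add: \<psi>_def scaleR_bcontfun.rep_eq T algebra_simps)
    next
      fix f
      have nT: "norm (T f) \<le> C * norm f" by (rule norm_bound) (simp add: T bound)
      have "\<bar>R (f, T f) n\<bar> \<le> vnorm c0_space (R (f, T f))"
        using R(1)[OF VT] by (intro c0_norm_upper) (simp add: Z)
      also have "\<dots> \<le> B * norm (f, T f)" by (rule R(4)[OF VT])
      also have "\<dots> \<le> \<bar>B\<bar> * (norm f + C * norm f)"
        using norm_Pair_le[of f "T f"] nT by (intro mult_mono) auto
      finally have "\<bar>\<psi> n f\<bar> \<le> C * norm f + \<bar>B\<bar> * (norm f + C * norm f)"
        using bound[of f n] unfolding \<psi>_def by linarith
      then show "norm (\<psi> n f) \<le> norm f * (C + \<bar>B\<bar> * (1 + C))"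
        by (simp add: algebra_simps)
    qed
    then obtain f where "\<not> (\<lambda>n. t f n - \<psi> n f) \<longlonglongrightarrow> 0" using no_lift by blast
    then show False using R(1)[OF VT] by (simp add: \<psi>_def)
  qed
  with ts show ?thesis by (rule nontrivial_twisted_sumI)
qed

section \<open>Partitions of a compact linear order\<close>

lemma apply_Bcontfun:
  assumes "compact (UNIV :: 'a::topological_space set)" "continuous_on UNIV f"
  shows "apply_bcontfun (Bcontfun f) = (f :: 'a \<Rightarrow> real)"
  using continuous_imp_bcontfun[OF assms] by (rule Bcontfun_inverse)

text \<open>A property of small sets spreads from punctured neighbourhoods to the gaps of a finite partition.
Puncturing matters: the centres of the neighbourhoods belong to the partition, so the property has
to hold only on the two sides of each centre.\<close>

lemma compact_partition:
  fixes Q :: "'a::linorder_topology set \<Rightarrow> bool"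
  assumes K: "compact (UNIV :: 'a set)"
    and mono: "\<And>A B. A \<subseteq> B \<Longrightarrow> Q B \<Longrightarrow> Q A"
    and loc: "\<And>x. \<exists>U. open U \<and> x \<in> U \<and> Q (U - {x})"
  obtains P where "finite P"
    "\<And>I. \<lbrakk>\<And>a b. a \<in> I \<Longrightarrow> b \<in> I \<Longrightarrow> {a..b} \<subseteq> I; I \<inter> P = {}\<rbrakk> \<Longrightarrow> Q I"
proof -
  define B where "B L H = (\<Inter>y\<in>L. {y<..}) \<inter> (\<Inter>z\<in>H. {..<z})" for L H :: "'a set"
  have nbhd: "\<exists>L H. finite L \<and> finite H \<and> x \<in> B L H \<and> B L H \<subseteq> U" if U: "open U" "x \<in> U" for x U
  proof -
    obtain L where L: "finite L" "\<forall>y\<in>L. y < x" "\<And>t. t \<le> x \<Longrightarrow> \<forall>y\<in>L. y < t \<Longrightarrow> t \<in> U"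
    proof (cases "\<exists>y. y < x")
      case True
      then obtain y where "y < x" "{y<..x} \<subseteq> U" using open_left[OF U] by blast
      then show thesis by (intro that[of "{y}"]) auto
    next
      case False
      then show thesis using U(2) by (intro that[of "{}"]) (auto simp: not_less dest: order.antisym)
    qed
    obtain H where H: "finite H" "\<forall>z\<in>H. x < z" "\<And>t. x \<le> t \<Longrightarrow> \<forall>z\<in>H. t < z \<Longrightarrow> t \<in> U"
    proof (cases "\<exists>z. x < z")
      case True
      then obtain z where "x < z" "{x..<z} \<subseteq> U" using open_right[OF U] by blast
      then show thesis by (intro that[of "{z}"]) auto
    next
      case False
      then show thesis using U(2) by (intro that[of "{}"]) (auto simp: not_less dest: order.antisym)
    qed
    have "B L H \<subseteq> U"
    proof
      fix t assume "t \<in> B L H"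
      then show "t \<in> U" using L(3)[of t] H(3)[of t] by (cases "t \<le> x") (auto simp: B_def)
    qed
    moreover have "x \<in> B L H" using L(2) H(2) by (auto simp: B_def)
    ultimately show ?thesis using L(1) H(1) by blast
  qed
  have "\<exists>U L H. Q (U - {x}) \<and> finite L \<and> finite H \<and> x \<in> B L H \<and> B L H \<subseteq> U" for x
  proof -
    obtain U where U: "open U" "x \<in> U" "Q (U - {x})" using loc[of x] by blast
    show ?thesis using nbhd[OF U(1,2)] U(3) by blast
  qed
  then obtain U L H where ULH: "\<And>x. Q (U x - {x})" "\<And>x. finite (L x)" "\<And>x. finite (H x)"
      "\<And>x. x \<in> B (L x) (H x)" "\<And>x. B (L x) (H x) \<subseteq> U x"
    by metis
  have op: "open (B (L x) (H x))" for x
    unfolding B_def using ULH by (intro open_Int open_INT) auto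
  have cov: "UNIV \<subseteq> (\<Union>x\<in>UNIV. B (L x) (H x))" using ULH(4) by blast
  obtain D where D: "finite D" "UNIV \<subseteq> (\<Union>x\<in>D. B (L x) (H x))"
    by (rule compactE_image[OF K op cov]) simp
  show thesis
  proof (rule that[of "D \<union> (\<Union>x\<in>D. L x \<union> H x)"])
    show "finite (D \<union> (\<Union>x\<in>D. L x \<union> H x))" using D ULH by auto
    fix I assume I: "\<And>a b. a \<in> I \<Longrightarrow> b \<in> I \<Longrightarrow> {a..b} \<subseteq> I" "I \<inter> (D \<union> (\<Union>x\<in>D. L x \<union> H x)) = {}"
    show "Q I"
    proof (cases "I = {}")
      case True
      then show ?thesis using ULH(1)[of undefined] mono[of "{}"] by blast
    next
      case False
      then obtain t where t: "t \<in> I" by blast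
      then obtain x where x: "x \<in> D" "t \<in> B (L x) (H x)" using D by blast
      have "s \<in> U x - {x}" if s: "s \<in> I" for s
      proof -
        have "y < s" if y: "y \<in> L x" for y
        proof (rule ccontr)
          assume "\<not> y < s"
          then have "y \<in> {s..t}" using x(2) y by (force simp: B_def)
          then show False using I(1)[OF s t] I(2) x(1) y by blast
        qed
        moreover have "s < z" if z: "z \<in> H x" for z
        proof (rule ccontr)
          assume "\<not> s < z"
          then have "z \<in> {t..s}" using x(2) z by (force simp: B_def)
          then show False using I(1)[OF t s] I(2) x(1) z by blast
        qed
        ultimately have "s \<in> B (L x) (H x)" by (auto simp: B_def)
        then show ?thesis using ULH(5) s I(2) x(1) by blast
      qed
      then show ?thesis using mono[OF _ ULH(1)[of x]] by blast
    qed
  qed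
qed

lemma oscillation_partition:
  fixes f :: "'a::linorder_topology \<Rightarrow> real"
  assumes "compact (UNIV :: 'a set)" "continuous_on UNIV f" "\<delta> > 0"
  obtains P where "finite P"
    "\<And>I s t. \<lbrakk>\<And>a b. a \<in> I \<Longrightarrow> b \<in> I \<Longrightarrow> {a..b} \<subseteq> I; I \<inter> P = {}; s \<in> I; t \<in> I\<rbrakk> \<Longrightarrow> \<bar>f s - f t\<bar> < \<delta>"
proof -
  define Q where "Q I \<longleftrightarrow> (\<forall>s\<in>I. \<forall>t\<in>I. \<bar>f s - f t\<bar> < \<delta>)" for I
  have mono: "Q A" if "A \<subseteq> B" "Q B" for A B
    using that unfolding Q_def by blast
  have loc: "\<exists>U. open U \<and> x \<in> U \<and> Q (U - {x})" for x
  proof -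
    have "open (f -` ball (f x) (\<delta> / 2))"
      using assms(2) by (intro open_vimage) auto
    moreover have "\<bar>f s - f t\<bar> < \<delta>"
      if "s \<in> f -` ball (f x) (\<delta> / 2)" "t \<in> f -` ball (f x) (\<delta> / 2)" for s t
      using that unfolding vimage_def mem_Collect_eq mem_ball dist_real_def by linarith
    ultimately show ?thesis
      using assms(3) unfolding Q_def by (intro exI[of _ "f -` ball (f x) (\<delta> / 2)"]) auto
  qed
  show thesis
  proof (rule compact_partition[OF assms(1) mono loc])
    fix P assume P: "finite P" "\<And>I. \<lbrakk>\<And>a b. a \<in> I \<Longrightarrow> b \<in> I \<Longrightarrow> {a..b} \<subseteq> I; I \<inter> P = {}\<rbrakk> \<Longrightarrow> Q I"
    show thesis
    proof (rule that[OF P(1)])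
      fix I s t assume I: "\<And>a b. a \<in> I \<Longrightarrow> b \<in> I \<Longrightarrow> {a..b} \<subseteq> I" "I \<inter> P = {}" "s \<in> I" "t \<in> I"
      have "Q I" using I(1,2) by (rule P(2))
      then show "\<bar>f s - f t\<bar> < \<delta>" using I(3,4) by (simp add: Q_def)
    qed
  qed
qed

text \<open>The least and the greatest element are added to \<open>P\<close>, so that the intervals between consecutive
terms cover the whole order.\<close>

lemma finite_chain_enumeration:
  fixes P :: "'a::linorder_topology set"
  assumes K: "compact (UNIV :: 'a set)" and "finite P"
  shows "\<exists>(a :: nat \<Rightarrow> 'a) m. P \<subseteq> a ` {..m} \<and> (\<forall>x. a 0 \<le> x) \<and> (\<forall>x. x \<le> a m) \<and>
    (\<forall>i j. i < j \<longrightarrow> j \<le> m \<longrightarrow> a i < a j)"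
proof -
  obtain b where b: "\<And>x :: 'a. b \<le> x" using compact_attains_inf[OF K] by auto
  obtain t where t: "\<And>x :: 'a. x \<le> t" using compact_attains_sup[OF K] by auto
  define xs where "xs = sorted_list_of_set (insert b (insert t P))"
  have xs: "set xs = insert b (insert t P)" "sorted_wrt (<) xs"
    using assms(2) unfolding xs_def by (simp_all del: sorted_list_of_set_insert_remove)
  define m where "m = length xs - 1"
  have ne: "xs \<noteq> []" using xs by auto
  have lt: "xs ! i < xs ! j" if "i < j" "j \<le> m" for i j
    using that ne sorted_wrt_nth_less[OF xs(2)] by (auto simp: m_def)
  have set: "set xs = (!) xs ` {..m}"
  proof -
    have "{..<length xs} = {..m}" using ne by (cases xs) (auto simp: m_def)
    then show ?thesis by (auto simp: set_conv_nth)
  qed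
  have le: "xs ! i \<le> xs ! j" if "i \<le> j" "j \<le> m" for i j
    using lt[of i j] that by (cases "i = j") auto
  show ?thesis
  proof (intro exI[of _ "(!) xs"] exI[of _ m] conjI allI impI)
    show "P \<subseteq> (!) xs ` {..m}" using xs set by blast
    have "b \<in> (!) xs ` {..m}" "t \<in> (!) xs ` {..m}" using xs set by blast+
    then obtain i j where "i \<le> m" "b = xs ! i" "j \<le> m" "t = xs ! j" by auto
    then show "xs ! 0 \<le> x" "x \<le> xs ! m" for x
      using le[of 0 i] le[of j m] b[of x] t[of x] by auto
    show "xs ! i < xs ! j" if "i < j" "j \<le> m" for i j using that by (rule lt)
  qed
qed

text \<open>A Urysohn function for the two end points, composed with the retraction onto the interval, becomes
constant outside the interval.\<close>

lemma ramp_exists: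
  fixes a b :: "'a::linorder_topology"
  assumes K: "compact (UNIV :: 'a set)" and ab: "a < b"
  shows "\<exists>h :: 'a \<Rightarrow> real. continuous_on UNIV h \<and> (\<forall>x. 0 \<le> h x \<and> h x \<le> 1) \<and> (\<forall>x\<le>a. h x = 0) \<and> (\<forall>x\<ge>b. h x = 1)"
proof -
  have "Hausdorff_space (euclidean :: 'a topology)"
    unfolding Hausdorff_space_def by (simp add: disjnt_def) (meson hausdorff)
  moreover have "compact_space (euclidean :: 'a topology)"
    using K by (simp add: compact_space_def)
  ultimately have "normal_space (euclidean :: 'a topology)"
    by (intro compact_Hausdorff_or_regular_imp_normal_space) auto
  from Urysohn_lemma[OF this, of "{a}" "{b}" 0 1] ab
  obtain f where f: "continuous_map euclidean (top_of_set {0..1::real}) f" "f a = 0" "f b = 1"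
    by (auto simp: disjnt_def)
  have fc: "continuous_on UNIV f" "\<And>x. 0 \<le> f x \<and> f x \<le> 1"
    using f(1) by (auto simp: continuous_map_in_subtopology)
  define h where "h x = f (max a (min b x))" for x
  have "continuous_on UNIV h"
    unfolding h_def by (intro continuous_on_compose2[OF fc(1)] continuous_intros) auto
  moreover have "\<forall>x\<le>a. h x = 0" "\<forall>x\<ge>b. h x = 1"
    using ab f by (auto simp: h_def min_def max_def)
  ultimately show ?thesis using fc(2) by (auto simp: h_def)
qed

definition ramp :: "'a::linorder_topology \<Rightarrow> 'a \<Rightarrow> 'a \<Rightarrow> real" where
  "ramp a b = (SOME h. continuous_on UNIV h \<and> (\<forall>x. 0 \<le> h x \<and> h x \<le> 1) \<and> (\<forall>x\<le>a. h x = 0) \<and> (\<forall>x\<ge>b. h x = 1))"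

lemma ramp:
  assumes "compact (UNIV :: 'a::linorder_topology set)" "a < b"
  shows "continuous_on UNIV (ramp a b)" "0 \<le> ramp a b x" "ramp a b x \<le> 1"
    "x \<le> a \<Longrightarrow> ramp a b x = 0" "b \<le> (x::'a) \<Longrightarrow> ramp a b x = 1"
proof -
  have *: "continuous_on UNIV (ramp a b) \<and> (\<forall>x. 0 \<le> ramp a b x \<and> ramp a b x \<le> 1) \<and>
      (\<forall>x\<le>a. ramp a b x = 0) \<and> (\<forall>x\<ge>b. ramp a b x = 1)"
    unfolding ramp_def by (rule someI_ex[OF ramp_exists[OF assms]])
  show "continuous_on UNIV (ramp a b)" "0 \<le> ramp a b x" "ramp a b x \<le> 1"
    "x \<le> a \<Longrightarrow> ramp a b x = 0" "b \<le> x \<Longrightarrow> ramp a b x = 1"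
    using * by simp_all
qed

lemma abs_sum_le_card_support:
  fixes g :: "'i \<Rightarrow> real"
  assumes "finite G" "\<And>i. i \<in> G \<Longrightarrow> \<bar>g i\<bar> \<le> c" "card {i\<in>G. g i \<noteq> 0} \<le> k" "c \<ge> 0"
  shows "\<bar>\<Sum>i\<in>G. g i\<bar> \<le> real k * c"
proof -
  have "(\<Sum>i\<in>G. g i) = (\<Sum>i\<in>{i\<in>G. g i \<noteq> 0}. g i)"
    using assms(1) by (intro sum.mono_neutral_right) auto
  also have "\<bar>\<dots>\<bar> \<le> real (card {i\<in>G. g i \<noteq> 0}) * c"
    using assms(2) sum_norm_bound[of "{i\<in>G. g i \<noteq> 0}" g c] by auto
  also have "\<dots> \<le> real k * c" using assms by (intro mult_right_mono) auto
  finally show ?thesis .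
qed

section \<open>Functionals and functions on a compact linear order\<close>

lemma bounded_linear_abs_bound:
  assumes "bounded_linear (\<psi> :: 'b::real_normed_vector \<Rightarrow> real)"
  obtains B where "B > 0" "\<And>f. \<bar>\<psi> f\<bar> \<le> B * norm f"
proof -
  obtain B where "B > 0" "\<And>f. norm (\<psi> f) \<le> norm f * B"
    using bounded_linear.pos_bounded[OF assms] by blast
  then show thesis by (intro that[of B]) (simp_all add: mult.commute)
qed

lemma norm_bcontfun_le:
  fixes f :: "'a::topological_space \<Rightarrow>\<^sub>C real"
  shows "(\<And>x. \<bar>f x\<bar> \<le> c) \<Longrightarrow> norm f \<le> c"
  by (rule norm_bound) simp

lemma abs_apply_le: "\<bar>apply_bcontfun f x\<bar> \<le> norm (f :: 'a::topological_space \<Rightarrow>\<^sub>C real)"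
  using norm_bounded[of f x] by simp

lemma apply_bcontfun_sum:
  fixes F :: "'i \<Rightarrow> 'a::topological_space \<Rightarrow>\<^sub>C real"
  shows "apply_bcontfun (\<Sum>i\<in>I. F i) x = (\<Sum>i\<in>I. apply_bcontfun (F i) x)"
  by (induction I rule: infinite_finite_induct) (auto simp: plus_bcontfun.rep_eq zero_bcontfun.rep_eq)

text \<open>Among the functions bounded by 1 that vanish at \<open>x\<close>, choose \<open>g\<close> with \<open>\<psi> g\<close> almost maximal, and
truncate it so that it vanishes near \<open>x\<close>. Adding or subtracting a function \<open>k\<close> that lives where \<open>g\<close>
vanishes stays within the competition, so \<open>\<bar>\<psi> k\<bar>\<close> cannot exceed the amount by which \<open>g\<close> misses the
supremum.\<close>

lemma small_variation_punctured_nbhd: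
  fixes \<psi> :: "('a::topological_space \<Rightarrow>\<^sub>C real) \<Rightarrow> real"
  assumes K: "compact (UNIV :: 'a set)" and \<psi>: "bounded_linear \<psi>" and e: "\<epsilon> > 0"
  shows "\<exists>U. open U \<and> x \<in> U \<and> (\<forall>k. (\<forall>y. \<bar>apply_bcontfun k y\<bar> \<le> 1) \<and> (\<forall>y. y \<notin> U - {x} \<longrightarrow> k y = 0) \<longrightarrow> \<bar>\<psi> k\<bar> \<le> \<epsilon>)"
proof -
  interpret \<psi>: bounded_linear \<psi> by fact
  obtain B where B: "B > 0" "\<And>f. \<bar>\<psi> f\<bar> \<le> B * norm f"
    using \<psi> by (rule bounded_linear_abs_bound) blast
  define G where "G = {g :: 'a \<Rightarrow>\<^sub>C real. (\<forall>y. \<bar>g y\<bar> \<le> 1) \<and> g x = 0}"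
  have GB: "\<psi> g \<le> B" if "g \<in> G" for g
  proof -
    have "norm g \<le> 1" using that by (intro norm_bcontfun_le) (auto simp: G_def)
    then have "B * norm g \<le> B * 1" using B(1) by (intro mult_left_mono) auto
    then show ?thesis using B(2)[of g] by simp
  qed
  have bdd: "bdd_above (\<psi> ` G)" using GB by (intro bdd_aboveI2)
  have "0 \<in> G" by (simp add: G_def zero_bcontfun.rep_eq)
  then have ne: "\<psi> ` G \<noteq> {}" by blast
  define v where "v = (SUP g\<in>G. \<psi> g)"
  have v: "\<psi> g \<le> v" if "g \<in> G" for g
    unfolding v_def using bdd that by (rule cSUP_upper2) auto
  have "\<exists>g\<in>G. v - \<epsilon> / 2 < \<psi> g"
    using less_cSUP_iff[of G \<psi> "v - \<epsilon> / 2"] ne bdd e by (auto simp: v_def)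
  then obtain g where g: "g \<in> G" "v - \<epsilon> / 2 < \<psi> g" by blast
  define \<eta> where "\<eta> = \<epsilon> / (2 * B)"
  have eta: "\<eta> > 0" "B * \<eta> = \<epsilon> / 2" using B e by (auto simp: \<eta>_def)
  define g' where "g' = Bcontfun (\<lambda>y. g y - max (- \<eta>) (min \<eta> (g y)))"
  have g': "g' y = g y - max (- \<eta>) (min \<eta> (g y))" for y
    unfolding g'_def by (subst apply_Bcontfun[OF K]) (auto intro!: continuous_intros)
  have "norm (g - g') \<le> \<eta>"
    using eta by (intro norm_bcontfun_le) (auto simp: minus_bcontfun.rep_eq g')
  then have "B * norm (g - g') \<le> B * \<eta>" using B(1) by simp
  then have "\<bar>\<psi> g - \<psi> g'\<bar> \<le> \<epsilon> / 2"
    using B(2)[of "g - g'"] eta by (simp add: \<psi>.diff)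
  then have vg': "v - \<epsilon> < \<psi> g'" using g(2) by linarith
  have g'1: "\<bar>g' y\<bar> \<le> 1" for y
  proof -
    have "\<bar>g y\<bar> \<le> 1" using g(1) by (auto simp: G_def)
    then show ?thesis using eta unfolding g' by (auto simp: max_def min_def)
  qed
  have g'0: "g' y = 0" if "\<bar>g y\<bar> < \<eta>" for y
    using that unfolding g' by (auto simp: max_def min_def)
  define U where "U = apply_bcontfun g -` ball 0 \<eta>"
  have "open U" unfolding U_def by (intro open_vimage) auto
  moreover have "x \<in> U" using g(1) eta by (auto simp: U_def G_def)
  moreover have "\<bar>\<psi> k\<bar> \<le> \<epsilon>" if k: "\<And>y. \<bar>apply_bcontfun k y\<bar> \<le> 1" "\<And>y. y \<notin> U - {x} \<Longrightarrow> k y = 0" for k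
  proof -
    have "g' y = 0 \<or> k y = 0" for y
      using g'0[of y] k(2)[of y] by (auto simp: U_def)
    then have "\<bar>g' y + k y\<bar> \<le> 1" "\<bar>g' y - k y\<bar> \<le> 1" for y
      using g'1[of y] k(1)[of y] by (metis add.right_neutral add_0 diff_0 diff_zero abs_minus_cancel)+
    moreover have "g' x = 0" "k x = 0"
      using g'0[of x] g(1) eta k(2)[of x] by (auto simp: G_def)
    ultimately have "g' + k \<in> G" "g' - k \<in> G"
      by (auto simp: G_def plus_bcontfun.rep_eq minus_bcontfun.rep_eq)
    then have "\<psi> g' + \<psi> k \<le> v" "\<psi> g' - \<psi> k \<le> v"
      using v by (metis \<psi>.add, metis \<psi>.diff)
    then show ?thesis using vg' by linarith
  qed
  ultimately show ?thesis by blast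
qed

text \<open>The error of interpolating \<open>f\<close> at the points \<open>a i\<close> is a sum of functions \<open>E i\<close>, each supported in one
gap. If the closed gap contains no point of \<open>R\<close>, then \<open>E i\<close> is uniformly small since \<open>f\<close> oscillates
little there, and the sum of all these \<open>E i\<close> is as small as each of them because the supports are
disjoint. The remaining gaps are at most twice as many as the points of \<open>R\<close>, and there the small
variation of \<open>\<psi>\<close> takes over. The point is that \<open>\<epsilon>\<close> belongs to the partition \<open>a\<close>, whereas \<open>R\<close> and
\<open>\<delta>\<close> belong to \<open>f\<close>: refining \<open>a\<close> does not increase the number of points of \<open>R\<close>.\<close>

lemma interpolation_error:
  fixes \<psi> :: "('a::linorder_topology \<Rightarrow>\<^sub>C real) \<Rightarrow> real" and a :: "nat \<Rightarrow> 'a"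
  assumes K: "compact (UNIV :: 'a set)" and \<psi>: "bounded_linear \<psi>"
    and B: "\<And>f. \<bar>\<psi> f\<bar> \<le> B * norm f" "B \<ge> 0"
    and a: "\<And>x. a 0 \<le> x" "\<And>x. x \<le> a m" "\<And>i j. i < j \<Longrightarrow> j \<le> m \<Longrightarrow> a i < a j"
    and small: "\<And>i k. \<lbrakk>i < m; \<And>y. \<bar>apply_bcontfun k y\<bar> \<le> 1; \<And>y. y \<notin> {a i<..<a (Suc i)} \<Longrightarrow> k y = 0\<rbrakk>
            \<Longrightarrow> \<bar>\<psi> k\<bar> \<le> \<epsilon>"
    and R: "finite R" "\<delta> \<ge> 0" "\<And>I s t. \<lbrakk>\<And>a b. a \<in> I \<Longrightarrow> b \<in> I \<Longrightarrow> {a..b} \<subseteq> I; I \<inter> R = {}; s \<in> I; t \<in> I\<rbrakk>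
            \<Longrightarrow> \<bar>apply_bcontfun f s - f t\<bar> \<le> \<delta>"
    and e: "\<epsilon> \<ge> 0"
  shows "\<bar>\<psi> f - (\<psi> (const_bcontfun 1) * f (a 0) +
            (\<Sum>i<m. \<psi> (Bcontfun (ramp (a i) (a (Suc i)))) * (f (a (Suc i)) - f (a i))))\<bar>
         \<le> 2 * real (card R) * (4 * norm f * \<epsilon>) + B * (2 * \<delta>)"
proof -
  interpret \<psi>: bounded_linear \<psi> by fact
  have a1: "a i < a (Suc i)" if "i < m" for i using a(3)[of i "Suc i"] that by simp
  have ale: "a i \<le> a j" if "i \<le> j" "j \<le> m" for i j
    using a(3)[of i j] that by (cases "i = j") auto
  note rc = ramp[OF K a1]
  define h where "h i = Bcontfun (ramp (a i) (a (Suc i)))" for i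
  have h: "apply_bcontfun (h i) = ramp (a i) (a (Suc i))" if "i < m" for i
    unfolding h_def by (rule apply_Bcontfun[OF K]) (rule rc[OF that])
  define c where "c i = f (a (Suc i)) - f (a i)" for i
  define E where "E i = Bcontfun (\<lambda>x. f (min x (a (Suc i))) - f (min x (a i)) - c i * ramp (a i) (a (Suc i)) x)" for i
  have E: "E i x = f (min x (a (Suc i))) - f (min x (a i)) - c i * ramp (a i) (a (Suc i)) x"
    if "i < m" for i x
    unfolding E_def
    by (subst apply_Bcontfun[OF K])
       (auto intro!: continuous_intros continuous_on_compose2[OF continuous_on_apply_bcontfun[of UNIV f]] rc that)
  have Eout: "E i x = 0" if "i < m" "x \<notin> {a i<..<a (Suc i)}" for i x
  proof (cases "x \<le> a i")
    case True
    then have "x \<le> a (Suc i)" using a1[OF that(1)] by simp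
    then show ?thesis using that(1) True by (simp add: E rc min_def)
  next
    case False
    then have "a (Suc i) \<le> x" using that(2) by (meson greaterThanLessThan_iff not_le)
    then show ?thesis using that a1[of i] False by (simp add: E rc min_def c_def)
  qed
  have Ein: "E i x = (f x - f (a i)) - c i * ramp (a i) (a (Suc i)) x" if "i < m" "x \<in> {a i<..<a (Suc i)}" for i x
  proof -
    have "min x (a (Suc i)) = x" "min x (a i) = a i" using that(2) by (auto simp: min_def)
    then show ?thesis using that(1) by (simp add: E)
  qed
  have cramp: "\<bar>c i * ramp (a i) (a (Suc i)) x\<bar> \<le> \<bar>c i\<bar>" if "i < m" for i x
    using rc(2,3)[OF that, of x] by (simp add: abs_mult mult_left_le)
  have Enorm: "\<bar>E i x\<bar> \<le> 4 * norm f" if "i < m" for i x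
  proof (cases "x \<in> {a i<..<a (Suc i)}")
    case True
    show ?thesis
      using Ein[OF that True] cramp[OF that, of x] abs_apply_le[of f x] abs_apply_le[of f "a i"]
        abs_apply_le[of f "a (Suc i)"] unfolding c_def by linarith
  next
    case False
    then show ?thesis using Eout[OF that] by simp
  qed
  have Esmall: "\<bar>E i x\<bar> \<le> 2 * \<delta>" if "i < m" "{a i..a (Suc i)} \<inter> R = {}" for i x
  proof (cases "x \<in> {a i<..<a (Suc i)}")
    case True
    have "\<bar>f x - f (a i)\<bar> \<le> \<delta>" "\<bar>c i\<bar> \<le> \<delta>"
      unfolding c_def using True that(2) a1[OF that(1)] by (intro R(3)[of "{a i..a (Suc i)}"]; force)+
    then show ?thesis
      using Ein[OF that(1) True] cramp[OF that(1), of x] by linarith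
  next
    case False
    then show ?thesis using Eout[OF that(1)] R(2) by simp
  qed
  \<comment> \<open>the sum of the increments \<open>f (min x (a (i + 1))) - f (min x (a i))\<close> telescopes\<close>
  have eq: "f = f (a 0) *\<^sub>R const_bcontfun 1 + (\<Sum>i<m. c i *\<^sub>R h i) + (\<Sum>i<m. E i)"
  proof (rule bcontfun_eqI)
    fix x :: 'a
    have "(\<Sum>i<m. c i * h i x) + (\<Sum>i<m. E i x) = (\<Sum>i<m. f (min x (a (Suc i))) - f (min x (a i)))"
      unfolding sum.distrib[symmetric] by (intro sum.cong) (auto simp: E h)
    also have "\<dots> = f (min x (a m)) - f (min x (a 0))" by (rule sum_lessThan_telescope)
    also have "\<dots> = f x - f (a 0)" using a(1,2)[of x] by (simp add: min_def)
    finally show "apply_bcontfun f x = apply_bcontfun (f (a 0) *\<^sub>R const_bcontfun 1 + (\<Sum>i<m. c i *\<^sub>R h i) + (\<Sum>i<m. E i)) x"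
      by (simp add: plus_bcontfun.rep_eq scaleR_bcontfun.rep_eq const_bcontfun.rep_eq apply_bcontfun_sum)
  qed
  define N where "N = {i. i < m \<and> {a i..a (Suc i)} \<inter> R \<noteq> {}}"
  have N: "finite N" "N \<subseteq> {..<m}" by (auto simp: N_def)
  have "\<psi> f - (\<psi> (const_bcontfun 1) * f (a 0) + (\<Sum>i<m. \<psi> (h i) * c i)) = (\<Sum>i<m. \<psi> (E i))"
    by (subst (1) eq) (simp add: \<psi>.add \<psi>.sum \<psi>.scaleR mult.commute)
  also have "\<dots> = (\<Sum>i\<in>N. \<psi> (E i)) + \<psi> (\<Sum>i\<in>{..<m} - N. E i)"
    using N by (simp add: \<psi>.sum sum.subset_diff)
  also have "\<bar>\<dots>\<bar> \<le> 2 * real (card R) * (4 * norm f * \<epsilon>) + B * (2 * \<delta>)"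
  proof -
    have ptE: "\<bar>\<psi> (E i)\<bar> \<le> 4 * norm f * \<epsilon>" if "i < m" for i
    proof (cases "f = 0")
      case True
      have "E i = 0" using Enorm[OF that] by (intro bcontfun_eqI) (simp add: True zero_bcontfun.rep_eq)
      then show ?thesis using e by (simp add: \<psi>.zero)
    next
      case False
      let ?s = "4 * norm f"
      have s: "?s > 0" using False by simp
      have "\<bar>\<psi> ((1 / ?s) *\<^sub>R E i)\<bar> \<le> \<epsilon>"
        using Enorm[OF that] Eout[OF that] s
        by (intro small[OF that]) (auto simp: scaleR_bcontfun.rep_eq divide_le_eq)
      then show ?thesis using s by (simp add: \<psi>.scaleR field_simps)
    qed
    have cardN: "card N \<le> 2 * card R"
    proof -
      have "N \<subseteq> (\<Union>r\<in>R. {i. i < m \<and> r \<in> {a i..a (Suc i)}})" by (auto simp: N_def)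
      then have "card N \<le> card (\<Union>r\<in>R. {i. i < m \<and> r \<in> {a i..a (Suc i)}})"
        using R(1) by (intro card_mono) auto
      also have "\<dots> \<le> (\<Sum>r\<in>R. card {i. i < m \<and> r \<in> {a i..a (Suc i)}})"
        using R(1) by (rule card_UN_le)
      also have "\<dots> \<le> (\<Sum>r\<in>R. 2)"
      proof (rule sum_mono)
        fix r
        show "card {i. i < m \<and> r \<in> {a i..a (Suc i)}} \<le> 2"
        proof (cases "{i. i < m \<and> r \<in> {a i..a (Suc i)}} = {}")
          case False
          define j where "j = (LEAST i. i < m \<and> r \<in> {a i..a (Suc i)})"
          have j: "j < m" "r \<in> {a j..a (Suc j)}"
            using False LeastI_ex[of "\<lambda>i. i < m \<and> r \<in> {a i..a (Suc i)}"] unfolding j_def by blast+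
          have "{i. i < m \<and> r \<in> {a i..a (Suc i)}} \<subseteq> {j, Suc j}"
          proof
            fix i assume i: "i \<in> {i. i < m \<and> r \<in> {a i..a (Suc i)}}"
            then have "j \<le> i" unfolding j_def by (intro Least_le) simp
            moreover have "\<not> Suc j < i" using a(3)[of "Suc j" i] i j by fastforce
            ultimately show "i \<in> {j, Suc j}" by auto
          qed
          then have "card {i. i < m \<and> r \<in> {a i..a (Suc i)}} \<le> card {j, Suc j}"
            by (intro card_mono) auto
          then show ?thesis by simp
        qed (simp only: card.empty)
      qed
      finally show ?thesis by simp
    qed
    have "\<bar>\<Sum>i\<in>N. \<psi> (E i)\<bar> \<le> (\<Sum>i\<in>N. \<bar>\<psi> (E i)\<bar>)" by (rule sum_abs)
    also have "\<dots> \<le> real (card N) * (4 * norm f * \<epsilon>)"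
      using ptE N by (intro sum_bounded_above) auto
    also have "\<dots> \<le> 2 * real (card R) * (4 * norm f * \<epsilon>)"
      using cardN e by (intro mult_right_mono) auto
    finally have 1: "\<bar>\<Sum>i\<in>N. \<psi> (E i)\<bar> \<le> 2 * real (card R) * (4 * norm f * \<epsilon>)" .
    have "norm (\<Sum>i\<in>{..<m} - N. E i) \<le> 2 * \<delta>"
    proof (rule norm_bcontfun_le)
      fix x :: 'a
      have "card {i \<in> {..<m} - N. E i x \<noteq> 0} \<le> 1"
      proof -
        have "i = j" if "i < m" "j < m" "E i x \<noteq> 0" "E j x \<noteq> 0" for i j
        proof (rule ccontr)
          assume "i \<noteq> j"
          have "x \<in> {a i<..<a (Suc i)}" "x \<in> {a j<..<a (Suc j)}" using Eout that by blast+
          then show False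
            using \<open>i \<noteq> j\<close> ale[of "Suc i" j] ale[of "Suc j" i] that(1,2)
            by (cases i j rule: linorder_cases) auto
        qed
        then show ?thesis by (intro card_le_Suc0_iff_eq[THEN iffD2, folded One_nat_def]) auto
      qed
      then have "\<bar>\<Sum>i\<in>{..<m} - N. E i x\<bar> \<le> real 1 * (2 * \<delta>)"
        using Esmall R(2) by (intro abs_sum_le_card_support) (auto simp: N_def)
      then show "\<bar>apply_bcontfun (\<Sum>i\<in>{..<m} - N. E i) x\<bar> \<le> 2 * \<delta>"
        by (simp add: apply_bcontfun_sum)
    qed
    then have "B * norm (\<Sum>i\<in>{..<m} - N. E i) \<le> B * (2 * \<delta>)" using B(2) by (rule mult_left_mono)
    with B(1)[of "\<Sum>i\<in>{..<m} - N. E i"] have 2: "\<bar>\<psi> (\<Sum>i\<in>{..<m} - N. E i)\<bar> \<le> B * (2 * \<delta>)"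
      by linarith
    from 1 2 show ?thesis by linarith
  qed
  finally show ?thesis by (simp add: h_def c_def)
qed

text \<open>A finite combination of point evaluations, in the shape that the composition of a functional with
an interpolation operator takes. Sequences in place of lists make the parameters easy to count.\<close>

definition molecule :: "nat \<Rightarrow> (nat \<Rightarrow> 'a) \<Rightarrow> real \<Rightarrow> (nat \<Rightarrow> real) \<Rightarrow> ('a::topological_space \<Rightarrow>\<^sub>C real) \<Rightarrow> real" where
  "molecule m a w c f = w * f (a 0) + (\<Sum>i<m. c i * (f (a (Suc i)) - f (a i)))"

text \<open>The partitions depend on \<open>\<psi>\<close> alone, so one sequence of molecules works for all \<open>f\<close>.\<close>

lemma functional_limit_of_molecules:
  fixes \<psi> :: "('a::linorder_topology \<Rightarrow>\<^sub>C real) \<Rightarrow> real"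
  assumes K: "compact (UNIV :: 'a set)" and \<psi>: "bounded_linear \<psi>"
  obtains m a w c where "\<And>f. (\<lambda>k::nat. molecule (m k) (a k) (w k) (c k) f) \<longlonglongrightarrow> \<psi> f"
proof -
  obtain B where B: "B > 0" "\<And>f. \<bar>\<psi> f\<bar> \<le> B * norm f"
    using \<psi> by (rule bounded_linear_abs_bound) blast
  define Q where "Q \<epsilon> I \<longleftrightarrow> (\<forall>k. (\<forall>y. \<bar>apply_bcontfun k y\<bar> \<le> 1) \<and> (\<forall>y. y \<notin> I \<longrightarrow> k y = 0) \<longrightarrow> \<bar>\<psi> k\<bar> \<le> \<epsilon>)" for \<epsilon> I
  have part: "\<exists>(a :: nat \<Rightarrow> 'a) m. (\<forall>x. a 0 \<le> x) \<and> (\<forall>x. x \<le> a m) \<and> (\<forall>i j. i < j \<longrightarrow> j \<le> m \<longrightarrow> a i < a j) \<and>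
      (\<forall>i<m. Q \<epsilon> {a i<..<a (Suc i)})" if e: "\<epsilon> > 0" for \<epsilon>
  proof -
    obtain P where P: "finite P"
      "\<And>I. \<lbrakk>\<And>a b. a \<in> I \<Longrightarrow> b \<in> I \<Longrightarrow> {a..b} \<subseteq> I; I \<inter> P = {}\<rbrakk> \<Longrightarrow> Q \<epsilon> I"
    proof (rule compact_partition[OF K, of "Q \<epsilon>"])
      show "Q \<epsilon> A" if "A \<subseteq> A'" "Q \<epsilon> A'" for A A' using that unfolding Q_def by blast
      show "\<exists>U. open U \<and> x \<in> U \<and> Q \<epsilon> (U - {x})" for x
        unfolding Q_def by (rule small_variation_punctured_nbhd[OF K \<psi> e])
    qed blast
    obtain a :: "nat \<Rightarrow> 'a" and m where a: "P \<subseteq> a ` {..m}" "\<forall>x. a 0 \<le> x" "\<forall>x. x \<le> a m"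
        "\<forall>i j. i < j \<longrightarrow> j \<le> m \<longrightarrow> a i < a j"
      using finite_chain_enumeration[OF K P(1)] by blast
    note a = a(1) a(2,3)[rule_format] a(4)[rule_format]
    have "Q \<epsilon> {a i<..<a (Suc i)}" if "i < m" for i
    proof (rule P(2))
      have "a j \<le> a i \<or> a (Suc i) \<le> a j" if "j \<le> m" for j
        using a(4)[of j i] a(4)[of "Suc i" j] that \<open>i < m\<close>
        by (cases "j < i"; cases "j = i"; cases "j = Suc i") auto
      then show "{a i<..<a (Suc i)} \<inter> P = {}" using a(1) by force
    qed auto
    with a show ?thesis by blast
  qed
  define \<epsilon> where "\<epsilon> k = inverse (real (Suc k))" for k
  have "\<exists>(a :: nat \<Rightarrow> 'a) m. (\<forall>x. a 0 \<le> x) \<and> (\<forall>x. x \<le> a m) \<and> (\<forall>i j. i < j \<longrightarrow> j \<le> m \<longrightarrow> a i < a j) \<and>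
      (\<forall>i<m. Q (\<epsilon> k) {a i<..<a (Suc i)})" for k
    by (rule part) (simp add: \<epsilon>_def)
  then obtain a :: "nat \<Rightarrow> nat \<Rightarrow> 'a" and m where am: "\<And>k x. a k 0 \<le> x" "\<And>k x. x \<le> a k (m k)"
      "\<And>k i j. i < j \<Longrightarrow> j \<le> m k \<Longrightarrow> a k i < a k j" "\<And>k i. i < m k \<Longrightarrow> Q (\<epsilon> k) {a k i<..<a k (Suc i)}"
    by metis
  define c where "c k i = \<psi> (Bcontfun (ramp (a k i) (a k (Suc i))))" for k i
  show thesis
  proof (rule that[of m a "\<lambda>_. \<psi> (const_bcontfun 1)" c])
    fix f
    show "(\<lambda>k. molecule (m k) (a k) (\<psi> (const_bcontfun 1)) (c k) f) \<longlonglongrightarrow> \<psi> f"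
    proof (rule tendstoI)
      fix r :: real assume r: "r > 0"
      define \<delta> where "\<delta> = r / (4 * B)"
      have d: "\<delta> > 0" "B * (2 * \<delta>) = r / 2" using r B by (auto simp: \<delta>_def)
      obtain R where R: "finite R" "\<And>I s t. \<lbrakk>\<And>a b. a \<in> I \<Longrightarrow> b \<in> I \<Longrightarrow> {a..b} \<subseteq> I; I \<inter> R = {}; s \<in> I; t \<in> I\<rbrakk>
            \<Longrightarrow> \<bar>apply_bcontfun f s - f t\<bar> < \<delta>"
        by (rule oscillation_partition[OF K continuous_on_apply_bcontfun[of UNIV f] d(1)]) blast
      have est: "\<bar>\<psi> f - molecule (m k) (a k) (\<psi> (const_bcontfun 1)) (c k) f\<bar>
          \<le> 2 * real (card R) * (4 * norm f * \<epsilon> k) + B * (2 * \<delta>)" for k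
        unfolding molecule_def c_def
      proof (rule interpolation_error[OF K \<psi> B(2)])
        show "\<bar>\<psi> g\<bar> \<le> \<epsilon> k" if "i < m k" "\<And>y. \<bar>apply_bcontfun g y\<bar> \<le> 1" 
          "\<And>y. y \<notin> {a k i<..<a k (Suc i)} \<Longrightarrow> g y = 0" for i g
          using am(4)[OF that(1)] that(2,3) unfolding Q_def by blast
        show "\<bar>apply_bcontfun f s - f t\<bar> \<le> \<delta>" 
          if "\<And>a b. a \<in> I \<Longrightarrow> b \<in> I \<Longrightarrow> {a..b} \<subseteq> I" "I \<inter> R = {}" "s \<in> I" "t \<in> I" for I s t
          using R(2)[OF that] by simp
      qed (use am R(1) d B(1) in \<open>auto simp: \<epsilon>_def\<close>)
      have "(\<lambda>k. 2 * real (card R) * (4 * norm f * \<epsilon> k)) \<longlonglongrightarrow> 2 * real (card R) * (4 * norm f * 0)"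
        unfolding \<epsilon>_def by (intro tendsto_intros LIMSEQ_inverse_real_of_nat)
      then have "(\<lambda>k. 2 * real (card R) * (4 * norm f * \<epsilon> k)) \<longlonglongrightarrow> 0" by simp
      moreover have "r / 2 > 0" using r by simp
      ultimately have "\<forall>\<^sub>F k in sequentially. \<bar>2 * real (card R) * (4 * norm f * \<epsilon> k)\<bar> < r / 2"
        using tendstoD[of "\<lambda>k. 2 * real (card R) * (4 * norm f * \<epsilon> k)" 0 sequentially "r / 2"]
        unfolding dist_real_def diff_0_right by blast
      then show "\<forall>\<^sub>F k in sequentially. dist (molecule (m k) (a k) (\<psi> (const_bcontfun 1)) (c k) f) (\<psi> f) < r"
      proof eventually_elim
        case (elim k)
        then show ?case using est[of k] d(2) by (simp add: dist_real_def)
      qed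
    qed
  qed
qed

lemma lepoll_real_functionals:
  assumes K: "compact (UNIV :: 'a::linorder_topology set)" and c: "(UNIV :: 'a set) \<lesssim> (UNIV :: real set)"
  shows "{\<psi> :: ('a \<Rightarrow>\<^sub>C real) \<Rightarrow> real. bounded_linear \<psi>} \<lesssim> (UNIV :: real set)"
proof -
  define Mol where "Mol = (\<lambda>(m, a, w, c). molecule m a w c :: ('a \<Rightarrow>\<^sub>C real) \<Rightarrow> real) ` UNIV"
  have s1: "(UNIV :: (nat \<Rightarrow> 'a) set) \<lesssim> (UNIV :: real set)" using lepoll_real_seq[OF c] by simp
  have s2: "(UNIV :: (nat \<Rightarrow> real) set) \<lesssim> (UNIV :: real set)"
    using lepoll_real_seq[of "UNIV :: real set"] by simp
  have s3: "(UNIV :: nat set) \<lesssim> (UNIV :: real set)"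
    using infinite_le_lepoll infinite_UNIV_char_0 by blast
  have "Mol \<lesssim> (UNIV :: (nat \<times> (nat \<Rightarrow> 'a) \<times> real \<times> (nat \<Rightarrow> real)) set)"
    unfolding Mol_def by (rule image_lepoll)
  also have "\<dots> \<lesssim> (UNIV :: real set)"
    unfolding UNIV_Times_UNIV[symmetric] by (intro lepoll_real_Times s1 s2 s3) auto
  finally have "{s :: nat \<Rightarrow> _. range s \<subseteq> Mol} \<lesssim> (UNIV :: real set)" by (rule lepoll_real_seq)
  moreover have "{\<psi> :: ('a \<Rightarrow>\<^sub>C real) \<Rightarrow> real. bounded_linear \<psi>} \<subseteq> (\<lambda>s f. lim (\<lambda>k. s k f)) ` {s. range s \<subseteq> Mol}"
  proof
    fix \<psi> :: "('a \<Rightarrow>\<^sub>C real) \<Rightarrow> real" assume "\<psi> \<in> {\<psi>. bounded_linear \<psi>}"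
    then have "bounded_linear \<psi>" by simp
    then obtain m a w c where *: "\<And>f. (\<lambda>k::nat. molecule (m k) (a k) (w k) (c k) f) \<longlonglongrightarrow> \<psi> f"
      using functional_limit_of_molecules[OF K] by metis
    show "\<psi> \<in> (\<lambda>s f. lim (\<lambda>k. s k f)) ` {s. range s \<subseteq> Mol}"
    proof (rule image_eqI)
      show "\<psi> = (\<lambda>f. lim (\<lambda>k. molecule (m k) (a k) (w k) (c k) f))"
        using limI[OF *] by auto
      show "(\<lambda>k. molecule (m k) (a k) (w k) (c k)) \<in> {s. range s \<subseteq> Mol}"
        unfolding Mol_def by (auto intro!: image_eqI[of _ _ "(m _, a _, w _, c _)"])
    qed
  qed
  ultimately show ?thesis by (meson subset_image_lepoll lepoll_trans)
qed

text \<open>A continuous function is a uniform limit of step functions. A step function is coded by a sequence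
of points, its values at these points and its values on the gaps between them; it is evaluated at
the first point of the sequence that is not to the left of the argument.\<close>

lemma lepoll_real_continuous:
  assumes K: "compact (UNIV :: 'a::linorder_topology set)" and c: "(UNIV :: 'a set) \<lesssim> (UNIV :: real set)"
  shows "(UNIV :: ('a \<Rightarrow>\<^sub>C real) set) \<lesssim> (UNIV :: real set)"
proof -
  define step :: "(nat \<Rightarrow> 'a) \<times> (nat \<Rightarrow> real) \<times> (nat \<Rightarrow> real) \<Rightarrow> 'a \<Rightarrow> real" where
    "step = (\<lambda>(a, v, w) x. let j = LEAST i. x \<le> a i in if x = a j then v j else w j)"
  have s1: "(UNIV :: (nat \<Rightarrow> 'a) set) \<lesssim> (UNIV :: real set)" using lepoll_real_seq[OF c] by simp
  have s2: "(UNIV :: (nat \<Rightarrow> real) set) \<lesssim> (UNIV :: real set)"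
    using lepoll_real_seq[of "UNIV :: real set"] by simp
  have "range step \<lesssim> (UNIV :: ((nat \<Rightarrow> 'a) \<times> (nat \<Rightarrow> real) \<times> (nat \<Rightarrow> real)) set)"
    by (rule image_lepoll)
  also have "\<dots> \<lesssim> (UNIV :: real set)"
    unfolding UNIV_Times_UNIV[symmetric] by (intro lepoll_real_Times s1 s2)
  finally have "{s :: nat \<Rightarrow> _. range s \<subseteq> range step} \<lesssim> (UNIV :: real set)" by (rule lepoll_real_seq)
  moreover have "(UNIV :: ('a \<Rightarrow>\<^sub>C real) set) \<subseteq> (\<lambda>s. Bcontfun (\<lambda>x. lim (\<lambda>k. s k x))) ` {s. range s \<subseteq> range step}"
  proof
    fix f :: "'a \<Rightarrow>\<^sub>C real"
    have approx: "\<exists>p. \<forall>x. \<bar>f x - step p x\<bar> < \<delta>" if d: "\<delta> > 0" for \<delta> :: real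
    proof -
      obtain P where P: "finite P" "\<And>I s t. \<lbrakk>\<And>a b. a \<in> I \<Longrightarrow> b \<in> I \<Longrightarrow> {a..b} \<subseteq> I; I \<inter> P = {}; s \<in> I; t \<in> I\<rbrakk>
            \<Longrightarrow> \<bar>apply_bcontfun f s - f t\<bar> < \<delta>"
        by (rule oscillation_partition[OF K continuous_on_apply_bcontfun[of UNIV f] d]) blast
      obtain a :: "nat \<Rightarrow> 'a" and m where a: "P \<subseteq> a ` {..m}" "\<forall>x. a 0 \<le> x" "\<forall>x. x \<le> a m"
          "\<forall>i j. i < j \<longrightarrow> j \<le> m \<longrightarrow> a i < a j"
        using finite_chain_enumeration[OF K P(1)] by blast
      note a = a(1) a(2,3)[rule_format] a(4)[rule_format]
      define w where "w j = f (SOME s. s \<in> {a (j - 1)<..<a j})" for j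
      have "\<bar>f x - step (a, (\<lambda>j. f (a j)), w) x\<bar> < \<delta>" for x
      proof -
        define j where "j = (LEAST i. x \<le> a i)"
        have j: "x \<le> a j" "j \<le> m"
          unfolding j_def using a(3)[of x] by (rule LeastI, rule Least_le)
        have jl: "a i < x" if "i < j" for i
          using not_less_Least[of i "\<lambda>i. x \<le> a i"] that unfolding j_def by simp
        have st: "step (a, v, w) x = (if x = a j then v j else w j)" for v w
          by (simp only: step_def j_def Let_def prod.case)
        show ?thesis
        proof (cases "x = a j")
          case True
          then show ?thesis unfolding st using d by simp
        next
          case False
          then have "j \<noteq> 0" using j(1) a(2)[of x] by (metis order.antisym)
          then have x: "x \<in> {a (j - 1)<..<a j}" using jl[of "j - 1"] j(1) False by simp
          define s where "s = (SOME s. s \<in> {a (j - 1)<..<a j})"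
          have s: "s \<in> {a (j - 1)<..<a j}" unfolding s_def using x by (rule someI)
          have mono: "a i \<le> a k" if "i \<le> k" "k \<le> m" for i k
            using a(4)[of i k] that by (cases "i = k") auto
          have "a i \<le> a (j - 1) \<or> a j \<le> a i" if "i \<le> m" for i
          proof (cases "i \<le> j - 1")
            case True
            then show ?thesis using mono[of i "j - 1"] j(2) by simp
          next
            case False
            then show ?thesis using mono[of j i] that by simp
          qed
          then have "{a (j - 1)<..<a j} \<inter> P = {}" using a(1) by force
          then have "\<bar>f x - f s\<bar> < \<delta>" using x s by (intro P(2)) auto
          then show ?thesis unfolding st using False by (simp add: w_def s_def)
        qed
      qed
      then show ?thesis by blast
    qed
    have "\<forall>k. \<exists>p. \<forall>x. \<bar>f x - step p x\<bar> < inverse (real (Suc k))"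
      by (intro allI approx) simp
    then obtain p where p: "\<And>k x. \<bar>f x - step (p k) x\<bar> < inverse (real (Suc k))" by metis
    have "(\<lambda>k. step (p k) x) \<longlonglongrightarrow> f x" for x
    proof (rule LIM_zero_cancel, rule Lim_null_comparison[OF _ LIMSEQ_inverse_real_of_nat], rule always_eventually, rule allI)
      show "norm (step (p k) x - f x) \<le> inverse (real (Suc k))" for k
        using p[of x k] by (simp add: abs_minus_commute)
    qed
    then have "(\<lambda>x. lim (\<lambda>k. step (p k) x)) = f" by (intro ext limI)
    then show "f \<in> (\<lambda>s. Bcontfun (\<lambda>x. lim (\<lambda>k. s k x))) ` {s. range s \<subseteq> range step}"
      by (intro image_eqI[of _ _ "\<lambda>k. step (p k)"]) (auto simp: apply_bcontfun_inverse)
  qed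
  ultimately show ?thesis by (meson subset_image_lepoll lepoll_trans)
qed

section \<open>Orders with an uncountable monotone chain\<close>

text \<open>Let \<open>d i f\<close> be the difference of \<open>f\<close> at \<open>m i\<close> and \<open>l i\<close>. For fixed \<open>f\<close> these numbers vanish at infinity
in \<open>i\<close>. The index \<open>i\<close>, a real, is approximated by dyadic cells; the cells that contain \<open>i\<close> form
an infinite set, and two different reals share only finitely many cells. The value of \<open>t f\<close> at a
cell is the \<open>d i f\<close> of largest modulus among the indices in the cell. Up to any \<open>\<epsilon>\<close> it is decided by
finitely many indices, and almost every cell contains at most one of these; hence \<open>t\<close> is linear up to null
sequences.

Against a lift, consider bumps \<open>b i\<close> supported in \<open>[l i, h i]\<close> with \<open>d i (b i) = 1\<close>. Since the supports
overlap at most three at a time, a functional is nonzero at countably many bumps only. A bump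
annihilated by the whole lift has \<open>t (b i)\<close> of modulus at least 1 along the cells of \<open>i\<close>.\<close>

theorem nontrivial_twisted_sum_of_triples:
  fixes l m h :: "real \<Rightarrow> 'a::linorder_topology"
  assumes K: "compact (UNIV :: 'a set)" and \<Gamma>: "uncountable \<Gamma>"
    and lmh: "\<And>i. i \<in> \<Gamma> \<Longrightarrow> l i < m i \<and> m i < h i"
    and few: "\<And>x. finite {i\<in>\<Gamma>. l i \<le> x \<and> x \<le> h i} \<and> card {i\<in>\<Gamma>. l i \<le> x \<and> x \<le> h i} \<le> 3"
  shows "nontrivial_twisted_sum_exists c0_space (CK_space TYPE('a))"
proof -
  define d where "d i f = apply_bcontfun f (m i) - apply_bcontfun f (l i)" for i and f :: "'a \<Rightarrow>\<^sub>C real"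
  have d_add: "d i (f + g) = d i f + d i g" and d_scale: "d i (a *\<^sub>R f) = a * d i f" for i a f g
    by (simp_all add: d_def plus_bcontfun.rep_eq scaleR_bcontfun.rep_eq algebra_simps)
  have d_le: "\<bar>d i f\<bar> \<le> 2 * norm f" for i f
    using abs_apply_le[of f "m i"] abs_apply_le[of f "l i"] unfolding d_def by linarith
  have d_fin: "finite {i\<in>\<Gamma>. \<epsilon> \<le> \<bar>d i f\<bar>}" if e: "\<epsilon> > 0" for \<epsilon> f
  proof -
    obtain R where R: "finite R" "\<And>I s t. \<lbrakk>\<And>a b. a \<in> I \<Longrightarrow> b \<in> I \<Longrightarrow> {a..b} \<subseteq> I; I \<inter> R = {}; s \<in> I; t \<in> I\<rbrakk>
            \<Longrightarrow> \<bar>apply_bcontfun f s - f t\<bar> < \<epsilon>"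
      by (rule oscillation_partition[OF K continuous_on_apply_bcontfun[of UNIV f] e]) blast
    have "{i\<in>\<Gamma>. \<epsilon> \<le> \<bar>d i f\<bar>} \<subseteq> (\<Union>x\<in>R. {i\<in>\<Gamma>. l i \<le> x \<and> x \<le> h i})"
    proof
      fix i assume i: "i \<in> {i\<in>\<Gamma>. \<epsilon> \<le> \<bar>d i f\<bar>}"
      have "{l i..m i} \<inter> R \<noteq> {}"
      proof
        assume "{l i..m i} \<inter> R = {}"
        then have "\<bar>f (m i) - f (l i)\<bar> < \<epsilon>"
          using i lmh[of i] by (intro R(2)[of "{l i..m i}"]) auto
        then show False using i by (simp add: d_def)
      qed
      then obtain x where "x \<in> R" "l i \<le> x" "x \<le> m i" by auto
      then show "i \<in> (\<Union>x\<in>R. {i\<in>\<Gamma>. l i \<le> x \<and> x \<le> h i})"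
        using i lmh[of i] by force
    qed
    then show ?thesis by (rule finite_subset) (use R(1) few in blast)
  qed
  \<comment> \<open>a natural number stands for a level \<open>k\<close> and a dyadic interval of length \<open>2\<^sup>-\<^sup>k\<close>\<close>
  define code where "code i k = int_encode \<lfloor>2 ^ k * i\<rfloor>" for i :: real and k :: nat
  define cell where "cell n = {i\<in>\<Gamma>. code i (fst (prod_decode n)) = snd (prod_decode n)}" for n
  have code_cell: "i \<in> cell (prod_encode (k, code i k))" if "i \<in> \<Gamma>" for i k
    using that by (simp add: cell_def)
  have sep: "finite {n. i \<in> cell n \<and> j \<in> cell n}" if ij: "i \<noteq> j" for i j
  proof -
    obtain N where N: "1 / \<bar>i - j\<bar> < 2 ^ N" using real_arch_pow[of 2 "1 / \<bar>i - j\<bar>"] by auto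
    have ne: "code i k \<noteq> code j k" if "N \<le> k" for k
    proof
      assume "code i k = code j k"
      then have "\<lfloor>2 ^ k * i\<rfloor> = \<lfloor>2 ^ k * j\<rfloor>"
        using inj_int_encode[of UNIV] by (simp add: code_def inj_eq)
      then have "\<bar>2 ^ k * i - 2 ^ k * j\<bar> < 1" by linarith
      then have "2 ^ k * \<bar>i - j\<bar> < 1" by (simp add: abs_mult right_diff_distrib[symmetric])
      moreover have "(2::real) ^ N \<le> 2 ^ k" using that by (intro power_increasing) auto
      moreover have "1 < 2 ^ N * \<bar>i - j\<bar>" using N ij by (simp add: field_simps)
      ultimately show False using mult_right_mono[of "2 ^ N" "2 ^ k" "\<bar>i - j\<bar>"] by linarith
    qed
    have "{n. i \<in> cell n \<and> j \<in> cell n} \<subseteq> (\<lambda>k. prod_encode (k, code i k)) ` {..<N}"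
    proof
      fix n assume n: "n \<in> {n. i \<in> cell n \<and> j \<in> cell n}"
      define k where "k = fst (prod_decode n)"
      have "code i k = snd (prod_decode n)" "code j k = snd (prod_decode n)"
        using n by (auto simp: cell_def k_def)
      moreover from this have "k < N" using ne[of k] by (metis not_le)
      moreover have "n = prod_encode (k, snd (prod_decode n))" by (simp add: k_def)
      ultimately show "n \<in> (\<lambda>k. prod_encode (k, code i k)) ` {..<N}"
        by (intro image_eqI[of _ _ k]) simp_all
    qed
    then show ?thesis by (rule finite_subset) simp
  qed
  have inf: "infinite {n. i \<in> cell n}" if "i \<in> \<Gamma>" for i
  proof -
    have "inj (\<lambda>k. prod_encode (k, code i k))" by (rule injI) simp
    then have "infinite (range (\<lambda>k. prod_encode (k, code i k)))" by (rule range_inj_infinite)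
    moreover have "range (\<lambda>k. prod_encode (k, code i k)) \<subseteq> {n. i \<in> cell n}"
      using code_cell[OF that] by auto
    ultimately show ?thesis using infinite_super by blast
  qed
  define V where "V f n = insert 0 ((\<lambda>i. d i f) ` cell n)" for f n
  have max: "\<exists>v\<in>V f n. \<forall>v'\<in>V f n. \<bar>v'\<bar> \<le> \<bar>v\<bar>" for f n
  proof (cases "\<forall>i\<in>cell n. d i f = 0")
    case True
    then show ?thesis by (auto simp: V_def)
  next
    case False
    then obtain i0 where i0: "i0 \<in> cell n" "d i0 f \<noteq> 0" by blast
    define S where "S = {i\<in>cell n. \<bar>d i0 f\<bar> \<le> \<bar>d i f\<bar>}"
    have S: "finite S" "S \<noteq> {}"
      using d_fin[of "\<bar>d i0 f\<bar>" f] i0 by (auto simp: S_def cell_def elim: finite_subset[rotated])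
    obtain i where i: "i \<in> S" "\<And>j. j \<in> S \<Longrightarrow> \<bar>d j f\<bar> \<le> \<bar>d i f\<bar>"
    proof -
      have "Max ((\<lambda>i. \<bar>d i f\<bar>) ` S) \<in> (\<lambda>i. \<bar>d i f\<bar>) ` S" using S by (intro Max_in) auto
      then obtain i where i: "i \<in> S" "Max ((\<lambda>i. \<bar>d i f\<bar>) ` S) = \<bar>d i f\<bar>" by (rule imageE) blast
      have "\<bar>d j f\<bar> \<le> \<bar>d i f\<bar>" if "j \<in> S" for j
        unfolding i(2)[symmetric] using S(1) that by (intro Max_ge) auto
      then show thesis using i(1) by (intro that)
    qed
    have "\<bar>d j f\<bar> \<le> \<bar>d i f\<bar>" if "j \<in> cell n" for j
      using i(1) i(2)[of j] that by (cases "j \<in> S") (auto simp: S_def)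
    then show ?thesis using i(1) by (auto simp: V_def S_def)
  qed
  define t where "t f n = (SOME v. v \<in> V f n \<and> (\<forall>v'\<in>V f n. \<bar>v'\<bar> \<le> \<bar>v\<bar>))" for f n
  have t: "t f n \<in> V f n \<and> (\<forall>v'\<in>V f n. \<bar>v'\<bar> \<le> \<bar>t f n\<bar>)" for f n
    unfolding t_def by (rule someI_ex) (use max[of f n] in blast)
  have t_ge: "\<bar>d i f\<bar> \<le> \<bar>t f n\<bar>" if "i \<in> cell n" for i f n
    using t[of f n] that by (auto simp: V_def)
  have t_cases: "t f n = 0 \<or> (\<exists>i\<in>cell n. t f n = d i f)" for f n
    using t[of f n] by (auto simp: V_def)
  have t_le: "\<bar>t f n\<bar> \<le> 2 * norm f" for f n
    using t_cases[of f n] d_le[of _ f] by auto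
  have approx: "\<forall>\<^sub>F n in sequentially. \<exists>S. \<forall>f\<in>G. \<bar>t f n - (\<Sum>i\<in>S. d i f)\<bar> \<le> \<epsilon>"
    if G: "finite G" and e: "\<epsilon> > 0" for G \<epsilon>
  proof -
    \<comment> \<open>the indices that matter up to \<open>\<epsilon>\<close>\<close>
    define F where "F = (\<Union>f\<in>G. {i\<in>\<Gamma>. \<epsilon> / 2 \<le> \<bar>d i f\<bar>})"
    have F: "finite F" using G d_fin[of "\<epsilon> / 2"] e by (auto simp: F_def)
    have "finite (\<Union>i\<in>F. \<Union>j\<in>F - {i}. {n. i \<in> cell n \<and> j \<in> cell n})"
      using F sep by auto
    then have "\<forall>\<^sub>F n in sequentially. n \<notin> (\<Union>i\<in>F. \<Union>j\<in>F - {i}. {n. i \<in> cell n \<and> j \<in> cell n})"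
      by (simp only: cofinite_eq_sequentially[symmetric] eventually_cofinite not_not Collect_mem_eq)
    then show ?thesis
    proof eventually_elim
      case (elim n)
      have small: "\<bar>d j f\<bar> < \<epsilon> / 2" if "j \<in> cell n" "j \<notin> F" "f \<in> G" for j f
        using that by (auto simp: F_def cell_def not_le)
      have "\<bar>t f n - (\<Sum>i\<in>cell n \<inter> F. d i f)\<bar> \<le> \<epsilon>" if f: "f \<in> G" for f
      proof (cases "cell n \<inter> F = {}")
        case True
        have "\<bar>t f n\<bar> \<le> \<epsilon>" using t_cases[of f n] small[OF _ _ f] True e by fastforce
        with True show ?thesis by simp
      next
        case False
        then obtain i where i: "i \<in> cell n \<inter> F" by blast
        have eq: "cell n \<inter> F = {i}" using elim i by blast
        have "\<bar>t f n - d i f\<bar> \<le> \<epsilon>"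
        proof (cases "t f n = d i f")
          case False
          have "\<bar>t f n\<bar> \<le> \<epsilon> / 2"
          proof -
            consider "t f n = 0" | j where "j \<in> cell n" "t f n = d j f" using t_cases[of f n] by blast
            then show ?thesis
            proof cases
              case 2
              then have "j \<noteq> i" using False by auto
              then have "j \<notin> F" using eq 2(1) by blast
              then show ?thesis using small[OF 2(1) _ f] 2(2) by simp
            qed (use e in simp)
          qed
          moreover have "\<bar>d i f\<bar> \<le> \<bar>t f n\<bar>" using i by (intro t_ge) simp
          ultimately show ?thesis by linarith
        qed (use e in simp)
        then show ?thesis unfolding eq by simp
      qed
      then show ?case by blast
    qed
  qed
  define b where "b i = Bcontfun (\<lambda>x. ramp (l i) (m i) x - ramp (m i) (h i) x)" for i
  have b: "apply_bcontfun (b i) x = ramp (l i) (m i) x - ramp (m i) (h i) x" if "i \<in> \<Gamma>" for i x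
    unfolding b_def using lmh[OF that]
    by (subst apply_Bcontfun[OF K]) (auto intro!: continuous_intros ramp[OF K])
  have b_le: "\<bar>b i x\<bar> \<le> 1" if "i \<in> \<Gamma>" for i x
    using lmh[OF that] ramp(2,3)[OF K, of "l i" "m i" x] ramp(2,3)[OF K, of "m i" "h i" x]
    unfolding b[OF that] by linarith
  have b_out: "b i x = 0" if i: "i \<in> \<Gamma>" and "\<not> (l i \<le> x \<and> x \<le> h i)" for i x
  proof -
    have "x \<le> l i \<or> h i \<le> x" using that(2) by auto
    then show ?thesis
    proof
      assume x: "x \<le> l i"
      then have "x \<le> m i" using lmh[OF i] by (meson less_imp_le order_trans)
      then show ?thesis unfolding b[OF i] using x lmh[OF i] ramp(4)[OF K] by simp
    next
      assume x: "h i \<le> x"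
      then have "m i \<le> x" using lmh[OF i] by (meson less_imp_le order_trans)
      then show ?thesis unfolding b[OF i] using x lmh[OF i] ramp(5)[OF K] by simp
    qed
  qed
  have d_b: "d i (b i) = 1" if i: "i \<in> \<Gamma>" for i
    using lmh[OF i] unfolding d_def b[OF i] by (simp add: ramp[OF K] less_imp_le)
  have null: "countable {i\<in>\<Gamma>. \<psi> (b i) \<noteq> 0}" if \<psi>: "bounded_linear \<psi>" for \<psi> :: "('a \<Rightarrow>\<^sub>C real) \<Rightarrow> real"
  proof -
    interpret \<psi>: bounded_linear \<psi> by fact
    obtain B where B: "B > 0" "\<And>f. \<bar>\<psi> f\<bar> \<le> B * norm f"
      using \<psi> by (rule bounded_linear_abs_bound) blast
    have sum: "(\<Sum>i\<in>G. \<bar>\<psi> (b i)\<bar>) \<le> B * 3" if G: "finite G" "G \<subseteq> \<Gamma>" for G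
    proof -
      define g where "g = (\<Sum>i\<in>G. sgn (\<psi> (b i)) *\<^sub>R b i)"
      have "norm g \<le> 3"
      proof (rule norm_bcontfun_le)
        fix x
        have "card {i\<in>G. sgn (\<psi> (b i)) * b i x \<noteq> 0} \<le> card {i\<in>\<Gamma>. l i \<le> x \<and> x \<le> h i}"
          using few[of x] G b_out by (intro card_mono) auto
        then have "card {i\<in>G. sgn (\<psi> (b i)) * b i x \<noteq> 0} \<le> 3" using few[of x] by simp
        then have "\<bar>\<Sum>i\<in>G. sgn (\<psi> (b i)) * b i x\<bar> \<le> real 3 * 1"
        proof (intro abs_sum_le_card_support G)
          show "\<bar>sgn (\<psi> (b i)) * b i x\<bar> \<le> 1" if "i \<in> G" for i
            using b_le[of i x] that G by (auto simp: abs_mult abs_sgn_eq)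
        qed auto
        then show "\<bar>apply_bcontfun g x\<bar> \<le> 3"
          by (simp add: g_def apply_bcontfun_sum scaleR_bcontfun.rep_eq)
      qed
      then have "B * norm g \<le> B * 3" using B(1) by simp
      moreover have "\<psi> g = (\<Sum>i\<in>G. \<bar>\<psi> (b i)\<bar>)"
        unfolding g_def \<psi>.sum by (intro sum.cong) (auto simp: \<psi>.scaleR abs_sgn mult.commute)
      ultimately show ?thesis using B(2)[of g] by linarith
    qed
    have fin: "finite {i\<in>\<Gamma>. inverse (real (Suc k)) \<le> \<bar>\<psi> (b i)\<bar>}" for k
    proof -
      have "card G \<le> nat \<lceil>B * 3 * real (Suc k)\<rceil>"
        if G: "G \<subseteq> {i\<in>\<Gamma>. inverse (real (Suc k)) \<le> \<bar>\<psi> (b i)\<bar>}" "finite G" for G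
      proof -
        have "real (card G) * inverse (real (Suc k)) \<le> (\<Sum>i\<in>G. \<bar>\<psi> (b i)\<bar>)"
          using G by (intro sum_bounded_below) auto
        also have "\<dots> \<le> B * 3" using G by (intro sum) auto
        finally have "real (card G) \<le> B * 3 * real (Suc k)"
          by (simp add: field_simps del: of_nat_Suc)
        then show ?thesis by linarith
      qed
      then show ?thesis using finite_if_finite_subsets_card_bdd by blast
    qed
    have "{i\<in>\<Gamma>. \<psi> (b i) \<noteq> 0} \<subseteq> (\<Union>k. {i\<in>\<Gamma>. inverse (real (Suc k)) \<le> \<bar>\<psi> (b i)\<bar>})"
    proof
      fix i assume i: "i \<in> {i\<in>\<Gamma>. \<psi> (b i) \<noteq> 0}"
      then obtain k where "inverse (real (Suc k)) < \<bar>\<psi> (b i)\<bar>"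
        using reals_Archimedean[of "\<bar>\<psi> (b i)\<bar>"] by auto
      then show "i \<in> (\<Union>k. {i\<in>\<Gamma>. inverse (real (Suc k)) \<le> \<bar>\<psi> (b i)\<bar>})"
        using i by (auto intro!: exI[of _ k])
    qed
    moreover have "countable (\<Union>k. {i\<in>\<Gamma>. inverse (real (Suc k)) \<le> \<bar>\<psi> (b i)\<bar>})"
      using countable_finite[OF fin] by (intro countable_UN) simp_all
    ultimately show ?thesis by (rule countable_subset)
  qed
  show ?thesis
  proof (rule nontrivial_twisted_sum_of_almost_linear[of t 2])
    fix f g
    show "(\<lambda>n. t (f + g) n - (t f n + t g n)) \<longlonglongrightarrow> 0"
    proof (rule tendstoI)
      fix r :: real assume r: "r > 0"
      have "\<forall>\<^sub>F n in sequentially. \<exists>S. \<forall>u\<in>{f, g, f + g}. \<bar>t u n - (\<Sum>i\<in>S. d i u)\<bar> \<le> r / 4"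
        using r by (intro approx) auto
      then show "\<forall>\<^sub>F n in sequentially. dist (t (f + g) n - (t f n + t g n)) 0 < r"
      proof eventually_elim
        case (elim n)
        then obtain S where S: "\<bar>t f n - (\<Sum>i\<in>S. d i f)\<bar> \<le> r / 4" "\<bar>t g n - (\<Sum>i\<in>S. d i g)\<bar> \<le> r / 4"
            "\<bar>t (f + g) n - (\<Sum>i\<in>S. d i (f + g))\<bar> \<le> r / 4" by blast
        have "(\<Sum>i\<in>S. d i (f + g)) = (\<Sum>i\<in>S. d i f) + (\<Sum>i\<in>S. d i g)"
          by (simp add: d_add sum.distrib)
        with S r show ?case unfolding dist_real_def diff_0_right by linarith
      qed
    qed
  next
    fix a f
    show "(\<lambda>n. t (a *\<^sub>R f) n - a * t f n) \<longlonglongrightarrow> 0"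
    proof (rule tendstoI)
      fix r :: real assume r: "r > 0"
      define k where "k = \<bar>a\<bar> + 1"
      have k: "k > 0" unfolding k_def by linarith
      define \<epsilon> where "\<epsilon> = r / 2 / k"
      have "\<epsilon> > 0" "k * \<epsilon> < r" using r k by (simp_all add: \<epsilon>_def)
      then have e: "\<epsilon> > 0" "(\<bar>a\<bar> + 1) * \<epsilon> < r" by (simp_all add: k_def)
      have "\<forall>\<^sub>F n in sequentially. \<exists>S. \<forall>u\<in>{f, a *\<^sub>R f}. \<bar>t u n - (\<Sum>i\<in>S. d i u)\<bar> \<le> \<epsilon>"
        using e by (intro approx) auto
      then show "\<forall>\<^sub>F n in sequentially. dist (t (a *\<^sub>R f) n - a * t f n) 0 < r"
      proof eventually_elim
        case (elim n)
        then obtain S where S: "\<bar>t f n - (\<Sum>i\<in>S. d i f)\<bar> \<le> \<epsilon>"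
            "\<bar>t (a *\<^sub>R f) n - (\<Sum>i\<in>S. d i (a *\<^sub>R f))\<bar> \<le> \<epsilon>" by blast
        have "(\<Sum>i\<in>S. d i (a *\<^sub>R f)) = a * (\<Sum>i\<in>S. d i f)"
          by (simp add: d_scale sum_distrib_left)
        moreover have "\<bar>a * t f n - a * (\<Sum>i\<in>S. d i f)\<bar> \<le> \<bar>a\<bar> * \<epsilon>"
          using S(1) by (simp add: abs_mult right_diff_distrib[symmetric] mult_left_mono)
        ultimately show ?case
          using S(2) e(2) unfolding dist_real_def diff_0_right by (simp add: distrib_right)
      qed
    qed
  next
    fix \<psi> :: "nat \<Rightarrow> ('a \<Rightarrow>\<^sub>C real) \<Rightarrow> real" assume \<psi>: "\<And>n. bounded_linear (\<psi> n)"
    have cn: "countable (\<Union>n. {i\<in>\<Gamma>. \<psi> n (b i) \<noteq> 0})" using null[OF \<psi>] by blast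
    have "\<not> \<Gamma> \<subseteq> (\<Union>n. {i\<in>\<Gamma>. \<psi> n (b i) \<noteq> 0})"
    proof
      assume "\<Gamma> \<subseteq> (\<Union>n. {i\<in>\<Gamma>. \<psi> n (b i) \<noteq> 0})"
      from countable_subset[OF this cn] \<Gamma> show False by contradiction
    qed
    then obtain i where i: "i \<in> \<Gamma>" "\<And>n. \<psi> n (b i) = 0" by auto
    have "\<not> (\<lambda>n. t (b i) n - \<psi> n (b i)) \<longlonglongrightarrow> 0"
    proof
      assume "(\<lambda>n. t (b i) n - \<psi> n (b i)) \<longlonglongrightarrow> 0"
      then have "(\<lambda>n. t (b i) n) \<longlonglongrightarrow> 0" by (simp add: i(2))
      from tendstoD[OF this, of 1] obtain N where N: "\<And>n. n \<ge> N \<Longrightarrow> \<bar>t (b i) n\<bar> < 1"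
        by (auto simp: eventually_sequentially)
      obtain n where "n \<ge> N" "i \<in> cell n"
        using inf[OF i(1)] unfolding infinite_nat_iff_unbounded_le by blast
      then show False using N[of n] t_ge[of i n "b i"] d_b[OF i(1)] by simp
    qed
    then show "\<exists>f. \<not> (\<lambda>n. t f n - \<psi> n f) \<longlonglongrightarrow> 0" by blast
  next
    show "\<bar>t f n\<bar> \<le> 2 * norm f" for f n by (rule t_le)
  qed (rule bcontfun_Cauchy_convergent)
qed

text \<open>Three consecutive members of the chain form a triple. The triples whose span contains a given point
start at three consecutive indices at most.\<close>

theorem nontrivial_twisted_sum_if_uncountable_chain:
  fixes c :: "real \<Rightarrow> 'a::linorder_topology" and r :: "real rel"
  assumes K: "compact (UNIV :: 'a set)"
    and r: "wf r" "trans r" "\<And>x y. x \<noteq> y \<Longrightarrow> (x, y) \<in> r \<or> (y, x) \<in> r" "\<And>x. countable {y. (y, x) \<in> r}"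
    and E: "uncountable E"
    and chain: "(\<forall>\<alpha>\<in>E. \<forall>\<beta>\<in>E. (\<alpha>, \<beta>) \<in> r \<longrightarrow> c \<alpha> < c \<beta>) \<or> (\<forall>\<alpha>\<in>E. \<forall>\<beta>\<in>E. (\<alpha>, \<beta>) \<in> r \<longrightarrow> c \<beta> < c \<alpha>)"
  shows "nontrivial_twisted_sum_exists c0_space (CK_space TYPE('a))"
proof -
  have "\<exists>\<beta>. (\<beta> \<in> E \<and> (\<alpha>, \<beta>) \<in> r) \<and> (\<forall>\<gamma>\<in>E. (\<alpha>, \<gamma>) \<in> r \<longrightarrow> \<gamma> = \<beta> \<or> (\<beta>, \<gamma>) \<in> r)" for \<alpha>
  proof -
    have "countable (insert \<alpha> {\<beta>. (\<beta>, \<alpha>) \<in> r})" using r(4)[of \<alpha>] by simp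
    then have "\<not> E \<subseteq> insert \<alpha> {\<beta>. (\<beta>, \<alpha>) \<in> r}" using E countable_subset[of E] by metis
    then obtain \<gamma> where "\<gamma> \<in> E" "\<gamma> \<noteq> \<alpha>" "(\<gamma>, \<alpha>) \<notin> r" by blast
    then have "\<gamma> \<in> {\<beta>\<in>E. (\<alpha>, \<beta>) \<in> r}" using r(3)[of \<gamma> \<alpha>] by blast
    then have "\<exists>\<beta>\<in>{\<beta>\<in>E. (\<alpha>, \<beta>) \<in> r}. \<forall>\<gamma>. (\<gamma>, \<beta>) \<in> r \<longrightarrow> \<gamma> \<notin> {\<beta>\<in>E. (\<alpha>, \<beta>) \<in> r}"
      by (rule r(1)[unfolded wf_eq_minimal, rule_format])
    then obtain \<beta> where \<beta>: "\<beta> \<in> E" "(\<alpha>, \<beta>) \<in> r" "\<And>\<gamma>. (\<gamma>, \<beta>) \<in> r \<Longrightarrow> \<gamma> \<in> E \<Longrightarrow> (\<alpha>, \<gamma>) \<notin> r"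
      by blast
    have "\<gamma> = \<beta> \<or> (\<beta>, \<gamma>) \<in> r" if "\<gamma> \<in> E" "(\<alpha>, \<gamma>) \<in> r" for \<gamma>
      using r(3)[of \<gamma> \<beta>] \<beta>(3)[of \<gamma>] that by blast
    with \<beta>(1,2) show ?thesis by (intro exI[of _ \<beta>]) simp
  qed
  note succ_ex = this
  \<comment> \<open>the successor in \<open>E\<close>, which exists because \<open>E\<close> is not contained in a countable initial segment\<close>
  define s where "s \<alpha> = (SOME \<beta>. (\<beta> \<in> E \<and> (\<alpha>, \<beta>) \<in> r) \<and> (\<forall>\<gamma>\<in>E. (\<alpha>, \<gamma>) \<in> r \<longrightarrow> \<gamma> = \<beta> \<or> (\<beta>, \<gamma>) \<in> r))" for \<alpha>
  have s_all: "(s \<alpha> \<in> E \<and> (\<alpha>, s \<alpha>) \<in> r) \<and> (\<forall>\<gamma>\<in>E. (\<alpha>, \<gamma>) \<in> r \<longrightarrow> \<gamma> = s \<alpha> \<or> (s \<alpha>, \<gamma>) \<in> r)" for \<alpha>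
    unfolding s_def by (rule someI_ex[OF succ_ex])
  have s: "s \<alpha> \<in> E" "(\<alpha>, s \<alpha>) \<in> r"
      "\<gamma> \<in> E \<Longrightarrow> (\<alpha>, \<gamma>) \<in> r \<Longrightarrow> \<gamma> = s \<alpha> \<or> (s \<alpha>, \<gamma>) \<in> r" for \<alpha> \<gamma>
    using s_all[of \<alpha>] by auto
  have few: "finite A \<and> card A \<le> 3" if A: "A \<subseteq> E" "\<And>\<alpha> \<beta>. \<alpha> \<in> A \<Longrightarrow> \<beta> \<in> A \<Longrightarrow> (s (s \<alpha>), \<beta>) \<notin> r" for A
  proof (cases "A = {}")
    case False
    then obtain \<gamma> where "\<gamma> \<in> A" by blast
    then have "\<exists>\<alpha>\<in>A. \<forall>\<beta>. (\<beta>, \<alpha>) \<in> r \<longrightarrow> \<beta> \<notin> A"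
      by (rule r(1)[unfolded wf_eq_minimal, rule_format])
    then obtain \<alpha> where \<alpha>: "\<alpha> \<in> A" "\<And>\<beta>. (\<beta>, \<alpha>) \<in> r \<Longrightarrow> \<beta> \<notin> A" by blast
    have sub: "A \<subseteq> {\<alpha>, s \<alpha>, s (s \<alpha>)}"
    proof
      fix \<beta> assume \<beta>: "\<beta> \<in> A"
      then have "\<beta> = \<alpha> \<or> (\<alpha>, \<beta>) \<in> r" using \<alpha>(2) r(3) by blast
      then show "\<beta> \<in> {\<alpha>, s \<alpha>, s (s \<alpha>)}"
        using s(3)[of \<beta> \<alpha>] s(3)[of \<beta> "s \<alpha>"] A(1) A(2)[OF \<alpha>(1) \<beta>] \<beta> by blast
    qed
    have "card {\<alpha>, s \<alpha>, s (s \<alpha>)} \<le> 3" by (simp add: card_insert_if)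
    then show ?thesis
      using finite_subset[OF sub] card_mono[OF _ sub] by simp
  qed simp
  show ?thesis
    using chain
  proof
    assume inc: "\<forall>\<alpha>\<in>E. \<forall>\<beta>\<in>E. (\<alpha>, \<beta>) \<in> r \<longrightarrow> c \<alpha> < c \<beta>"
    show ?thesis
    proof (rule nontrivial_twisted_sum_of_triples[OF K E, of c "\<lambda>\<alpha>. c (s \<alpha>)" "\<lambda>\<alpha>. c (s (s \<alpha>))"])
      show "c \<alpha> < c (s \<alpha>) \<and> c (s \<alpha>) < c (s (s \<alpha>))" if "\<alpha> \<in> E" for \<alpha>
        using inc s that by blast
      show "finite {\<alpha>\<in>E. c \<alpha> \<le> x \<and> x \<le> c (s (s \<alpha>))} \<and> card {\<alpha>\<in>E. c \<alpha> \<le> x \<and> x \<le> c (s (s \<alpha>))} \<le> 3" for x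
      proof (rule few)
        fix \<alpha> \<beta> assume "\<alpha> \<in> {\<alpha>\<in>E. c \<alpha> \<le> x \<and> x \<le> c (s (s \<alpha>))}" "\<beta> \<in> {\<alpha>\<in>E. c \<alpha> \<le> x \<and> x \<le> c (s (s \<alpha>))}"
        then have "c \<beta> \<le> c (s (s \<alpha>))" "\<beta> \<in> E" by (auto intro: order_trans)
        then show "(s (s \<alpha>), \<beta>) \<notin> r" using inc s(1) by (meson not_le)
      qed auto
    qed
  next
    assume dec: "\<forall>\<alpha>\<in>E. \<forall>\<beta>\<in>E. (\<alpha>, \<beta>) \<in> r \<longrightarrow> c \<beta> < c \<alpha>"
    show ?thesis
    proof (rule nontrivial_twisted_sum_of_triples[OF K E, of "\<lambda>\<alpha>. c (s (s \<alpha>))" "\<lambda>\<alpha>. c (s \<alpha>)" c])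
      show "c (s (s \<alpha>)) < c (s \<alpha>) \<and> c (s \<alpha>) < c \<alpha>" if "\<alpha> \<in> E" for \<alpha>
        using dec s that by blast
      show "finite {\<alpha>\<in>E. c (s (s \<alpha>)) \<le> x \<and> x \<le> c \<alpha>} \<and> card {\<alpha>\<in>E. c (s (s \<alpha>)) \<le> x \<and> x \<le> c \<alpha>} \<le> 3" for x
      proof (rule few)
        fix \<alpha> \<beta> assume "\<alpha> \<in> {\<alpha>\<in>E. c (s (s \<alpha>)) \<le> x \<and> x \<le> c \<alpha>}" "\<beta> \<in> {\<alpha>\<in>E. c (s (s \<alpha>)) \<le> x \<and> x \<le> c \<alpha>}"
        then have "c (s (s \<alpha>)) \<le> c \<beta>" "\<beta> \<in> E" by (auto intro: order_trans)
        then show "(s (s \<alpha>), \<beta>) \<notin> r" using dec s(1) by (meson not_le)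
      qed auto
    qed
  qed
qed

section \<open>Orders with at most continuum many points\<close>

text \<open>Countably many functions that separate points embed the compact space into a countable power of
the real line.\<close>

lemma metrizable_if_countably_separated:
  fixes F :: "('a::t2_space \<Rightarrow>\<^sub>C real) set"
  assumes K: "compact (UNIV :: 'a set)" and F: "countable F"
    and sep: "\<And>a b. a \<noteq> b \<Longrightarrow> \<exists>f\<in>F. apply_bcontfun f a \<noteq> f b"
  shows "metrizable_space (euclidean :: 'a topology)"
proof -
  define e where "e = from_nat_into (insert 0 F)"
  have e: "range e = insert 0 F" using F by (simp add: e_def range_from_nat_into)
  define G where "G x = (\<lambda>n. apply_bcontfun (e n) x)" for x
  have "inj G"
  proof (rule injI, rule ccontr)
    fix a b assume ab: "G a = G b" "a \<noteq> b"
    obtain f where f: "f \<in> F" "apply_bcontfun f a \<noteq> f b" using sep ab(2) by blast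
    have "f \<in> range e" using e f(1) by simp
    then obtain n where "f = e n" by (rule imageE)
    with f(2) fun_cong[OF ab(1), of n] show False by (simp add: G_def)
  qed
  moreover have "continuous_on UNIV G"
    unfolding G_def by (intro continuous_on_coordinatewise_then_product) simp
  ultimately obtain H where H: "homeomorphism UNIV (range G) G H"
    using homeomorphism_compact[OF K, of G "range G"] by blast
  then have "homeomorphic_maps (euclidean :: 'a topology) (top_of_set (range G)) G H"
    unfolding homeomorphic_maps_def homeomorphism_def
    by (auto simp: continuous_map_in_subtopology)
  then have "(euclidean :: 'a topology) homeomorphic_space top_of_set (range G)"
    unfolding homeomorphic_space_def by blast
  moreover have "metrizable_space (top_of_set (range G))"
    by (intro metrizable_space_subtopology metrizable_space_euclidean)
  ultimately show ?thesis using homeomorphic_metrizable_space by metis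
qed

text \<open>The sequences \<open>t i\<close> are, up to null sequences, the values on \<open>y i\<close> of one sequence of functionals
\<open>f \<mapsto> f(p\<^sub>n) - f(q\<^sub>n)\<close>. That these functionals vanish infinitely often leaves room for later choices.\<close>

definition tracked :: "('i \<Rightarrow> 'a::topological_space \<Rightarrow>\<^sub>C real) \<Rightarrow> ('i \<Rightarrow> nat \<Rightarrow> real) \<Rightarrow> 'i set \<Rightarrow> bool" where
  "tracked y t I \<longleftrightarrow> (\<exists>p q :: nat \<Rightarrow> 'a. infinite {n. p n = q n} \<and>
     (\<forall>i\<in>I. (\<lambda>n. y i (p n) - y i (q n) - t i n) \<longlonglongrightarrow> 0))"

lemma tracked_subset: "tracked y t I \<Longrightarrow> J \<subseteq> I \<Longrightarrow> tracked y t J"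
  unfolding tracked_def by blast

lemma tracked_cong: "(\<And>i. i \<in> I \<Longrightarrow> t i = t' i) \<Longrightarrow> tracked y t I \<longleftrightarrow> tracked y t' I"
  unfolding tracked_def by simp

lemma tracked_empty: "tracked y t {}"
  unfolding tracked_def by (rule exI[of _ "\<lambda>_. undefined"], rule exI[of _ "\<lambda>_. undefined"]) simp

text \<open>A diagonal argument: let \<open>p k\<close> and \<open>q k\<close> follow the first \<open>k + 1\<close> sequences, use them on the block
\<open>[b k, b (k + 1))\<close>, start the block late enough for accuracy \<open>1 / (k + 1)\<close>, and end it late enough to
contain a place where \<open>p k\<close> and \<open>q k\<close> coincide.\<close>

lemma tracked_countable:
  assumes I: "countable I" and fin: "\<And>J. finite J \<Longrightarrow> J \<subseteq> I \<Longrightarrow> tracked y t J"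
  shows "tracked y t I"
proof (cases "I = {}")
  case True
  then show ?thesis by (simp add: tracked_empty)
next
  case False
  define e where "e = from_nat_into I"
  have e: "range e = I" using I False by (simp add: e_def range_from_nat_into)
  have "tracked y t (e ` {..k})" for k :: nat
    using e by (intro fin) auto
  then have "\<forall>k. \<exists>p q. infinite {n. p n = q n} \<and> (\<forall>i\<in>e ` {..k}. (\<lambda>n. y i (p n) - y i (q n) - t i n) \<longlonglongrightarrow> 0)"
    unfolding tracked_def by blast
  then obtain p q where pq: "\<And>k. infinite {n. p k n = q k n}"
      "\<And>k i. i \<in> e ` {..k} \<Longrightarrow> (\<lambda>n. y i (p k n) - y i (q k n) - t i n) \<longlonglongrightarrow> 0"
    by metis
  have "\<exists>N. \<forall>n\<ge>N. \<forall>i\<in>e ` {..k}. \<bar>y i (p k n) - y i (q k n) - t i n\<bar> < inverse (real (Suc k))" for k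
  proof -
    have "\<forall>\<^sub>F n in sequentially. \<forall>i\<in>e ` {..k}. \<bar>y i (p k n) - y i (q k n) - t i n\<bar> < inverse (real (Suc k))"
    proof (intro eventually_ball_finite ballI)
      fix i assume "i \<in> e ` {..k}"
      from tendstoD[OF pq(2)[OF this], of "inverse (real (Suc k))"]
      show "\<forall>\<^sub>F n in sequentially. \<bar>y i (p k n) - y i (q k n) - t i n\<bar> < inverse (real (Suc k))"
        by (simp add: dist_real_def)
    qed simp
    then show ?thesis unfolding eventually_sequentially .
  qed
  then obtain N where N: "\<And>k n i. n \<ge> N k \<Longrightarrow> i \<in> e ` {..k} \<Longrightarrow>
      \<bar>y i (p k n) - y i (q k n) - t i n\<bar> < inverse (real (Suc k))"
    by metis
  have "\<exists>b. \<forall>k. N k \<le> b k \<and> (b k < b (Suc k) \<and> (\<exists>n\<in>{b k..<b (Suc k)}. p k n = q k n))"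
  proof (rule dependent_nat_choice)
    show "\<exists>x. N 0 \<le> x" by blast
    fix x k
    obtain n where n: "n \<ge> x" "p k n = q k n"
      using pq(1)[of k] unfolding infinite_nat_iff_unbounded_le by blast
    then show "\<exists>z. N (Suc k) \<le> z \<and> x < z \<and> (\<exists>n\<in>{x..<z}. p k n = q k n)"
      by (intro exI[of _ "max (Suc n) (N (Suc k))"]) (auto intro!: bexI[of _ n])
  qed
  then obtain b where b: "\<And>k. N k \<le> b k" "\<And>k. b k < b (Suc k)"
      "\<And>k. \<exists>n\<in>{b k..<b (Suc k)}. p k n = q k n" by metis
  have sm: "strict_mono b" using b(2) by (simp add: strict_mono_Suc_iff)
  have ge: "k \<le> b k" for k using sm by (rule strict_mono_imp_increasing)
  \<comment> \<open>the number of the block that contains \<open>n\<close>; the places before \<open>b 0\<close> are put into block 0\<close>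
  define \<kappa> where "\<kappa> n = (LEAST k. n < b (Suc k))" for n
  have k1: "n < b (Suc (\<kappa> n))" for n
    unfolding \<kappa>_def by (rule LeastI[of _ n]) (use ge[of "Suc n"] in simp)
  have k2: "j \<le> \<kappa> n" if "b j \<le> n" for j n
    using k1[of n] that strict_mono_less[OF sm, of j "Suc (\<kappa> n)"] by simp
  have k3: "b (\<kappa> n) \<le> n" if "b 0 \<le> n" for n
  proof (cases "\<kappa> n")
    case (Suc k)
    then show ?thesis using not_less_Least[of k "\<lambda>k. n < b (Suc k)"] by (simp add: \<kappa>_def)
  qed (use that in simp)
  have k4: "\<kappa> n = k" if "b k \<le> n" "n < b (Suc k)" for n k
    using k2[OF that(1)] Least_le[of "\<lambda>k. n < b (Suc k)" k] that(2) by (simp add: \<kappa>_def)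
  show ?thesis
    unfolding tracked_def
  proof (rule exI[of _ "\<lambda>n. p (\<kappa> n) n"], rule exI[of _ "\<lambda>n. q (\<kappa> n) n"], intro conjI ballI)
    show "infinite {n. p (\<kappa> n) n = q (\<kappa> n) n}"
      unfolding infinite_nat_iff_unbounded_le
    proof
      fix m
      obtain n where n: "b m \<le> n" "n < b (Suc m)" "p m n = q m n" using b(3)[of m] by auto
      then have "\<kappa> n = m" "m \<le> n" using k4 ge[of m] by auto
      with n show "\<exists>n\<ge>m. n \<in> {n. p (\<kappa> n) n = q (\<kappa> n) n}" by auto
    qed
    fix i assume "i \<in> I"
    then obtain j where j: "i = e j" using e by blast
    show "(\<lambda>n. y i (p (\<kappa> n) n) - y i (q (\<kappa> n) n) - t i n) \<longlonglongrightarrow> 0"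
    proof (rule LIMSEQ_I)
      fix r :: real assume "r > 0"
      then obtain k0 where k0: "inverse (real (Suc k0)) < r" using reals_Archimedean by blast
      show "\<exists>no. \<forall>n\<ge>no. norm (y i (p (\<kappa> n) n) - y i (q (\<kappa> n) n) - t i n - 0) < r"
      proof (intro exI allI impI)
        fix n assume n: "b (max j k0) \<le> n"
        then have k: "max j k0 \<le> \<kappa> n" by (rule k2)
        have "b 0 \<le> b (max j k0)" using sm by (simp add: strict_mono_less_eq)
        then have "N (\<kappa> n) \<le> n" using k3[of n] b(1)[of "\<kappa> n"] n by linarith
        then have "\<bar>y i (p (\<kappa> n) n) - y i (q (\<kappa> n) n) - t i n\<bar> < inverse (real (Suc (\<kappa> n)))"
          using k j by (intro N) auto
        also have "\<dots> \<le> inverse (real (Suc k0))" using k by (intro le_imp_inverse_le) auto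
        finally show "norm (y i (p (\<kappa> n) n) - y i (q (\<kappa> n) n) - t i n - 0) < r" using k0 by simp
      qed
    qed
  qed
qed

lemma infinite_nat_split:
  assumes "infinite (M :: nat set)"
  obtains M' where "M' \<subseteq> M" "infinite M'" "infinite (M - M')"
proof -
  have inj: "inj (enumerate M)" using assms strict_mono_enumerate strict_mono_imp_inj_on by blast
  define A where "A = enumerate M ` {n. even n}"
  define B where "B = enumerate M ` {n. odd n}"
  have "infinite {n :: nat. even n}" "infinite {n :: nat. odd n}"
    unfolding infinite_nat_iff_unbounded_le by (metis mem_Collect_eq dvd_triv_left le_add2 mult_2, metis mem_Collect_eq even_Suc dvd_triv_left le_Suc_eq le_add2 mult_2)
  then have AB: "infinite A" "infinite B"
    unfolding A_def B_def using inj by (auto dest!: finite_imageD intro: inj_on_subset)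
  have "B \<subseteq> M - A"
    unfolding A_def B_def using inj assms by (auto simp: enumerate_in_set inj_eq)
  moreover have "A \<subseteq> M" unfolding A_def using assms by (auto simp: enumerate_in_set)
  ultimately show thesis using AB that[of A] infinite_super by blast
qed

text \<open>One more value \<open>u\<close> can be chosen so as to avoid a given sequence \<open>v\<close>, provided that \<open>y \<alpha>\<close> separates
points \<open>a\<close> and \<open>b\<close> that the previous functions do not separate. On half of the places where \<open>p\<close> and
\<open>q\<close> coincide they may be replaced by \<open>a\<close> and \<open>b\<close>: the previous functions do not notice, but \<open>u\<close>
changes by a nonzero constant infinitely often. So \<open>u - v\<close> is not a null sequence for one of the two
versions of \<open>u\<close>.\<close>

lemma tracked_insert:
  assumes tr: "tracked y t I" and \<alpha>: "\<alpha> \<notin> I"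
  shows "\<exists>u. tracked y (t(\<alpha> := u)) (insert \<alpha> I) \<and> (\<forall>n. \<bar>u n\<bar> \<le> 2 * norm (y \<alpha>)) \<and>
    ((\<exists>a b. (\<forall>i\<in>I. apply_bcontfun (y i) a = y i b) \<and> y \<alpha> a \<noteq> y \<alpha> b) \<longrightarrow> \<not> (\<lambda>n. u n - v n) \<longlonglongrightarrow> 0)"
proof -
  obtain p q where pq: "infinite {n. p n = q n}" "\<And>i. i \<in> I \<Longrightarrow> (\<lambda>n. y i (p n) - y i (q n) - t i n) \<longlonglongrightarrow> 0"
    using tr unfolding tracked_def by blast
  have ext: "tracked y (t(\<alpha> := \<lambda>n. y \<alpha> (p' n) - y \<alpha> (q' n))) (insert \<alpha> I) \<and> (\<forall>n. \<bar>y \<alpha> (p' n) - y \<alpha> (q' n)\<bar> \<le> 2 * norm (y \<alpha>))"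
    if p': "infinite {n. p' n = q' n}" "\<And>i. i \<in> I \<Longrightarrow> (\<lambda>n. y i (p' n) - y i (q' n) - t i n) \<longlonglongrightarrow> 0" for p' q'
  proof
    show "tracked y (t(\<alpha> := \<lambda>n. y \<alpha> (p' n) - y \<alpha> (q' n))) (insert \<alpha> I)"
      unfolding tracked_def
      by (rule exI[of _ p'], rule exI[of _ q']) (use p' \<alpha> in \<open>auto simp: fun_upd_def\<close>)
    show "\<forall>n. \<bar>y \<alpha> (p' n) - y \<alpha> (q' n)\<bar> \<le> 2 * norm (y \<alpha>)"
    proof
      fix n
      show "\<bar>y \<alpha> (p' n) - y \<alpha> (q' n)\<bar> \<le> 2 * norm (y \<alpha>)"
        using abs_apply_le[of "y \<alpha>" "p' n"] abs_apply_le[of "y \<alpha>" "q' n"] by linarith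
    qed
  qed
  define u0 where "u0 n = y \<alpha> (p n) - y \<alpha> (q n)" for n
  have u0: "tracked y (t(\<alpha> := u0)) (insert \<alpha> I)" "\<forall>n. \<bar>u0 n\<bar> \<le> 2 * norm (y \<alpha>)"
    using ext[OF pq] unfolding u0_def by auto
  show ?thesis
  proof (cases "(\<exists>a b. (\<forall>i\<in>I. apply_bcontfun (y i) a = y i b) \<and> y \<alpha> a \<noteq> y \<alpha> b) \<and> (\<lambda>n. u0 n - v n) \<longlonglongrightarrow> 0")
    case False
    then show ?thesis using u0 by blast
  next
    case True
    then obtain a b where ab: "\<forall>i\<in>I. apply_bcontfun (y i) a = y i b" "apply_bcontfun (y \<alpha>) a \<noteq> y \<alpha> b"
      and lim0: "(\<lambda>n. u0 n - v n) \<longlonglongrightarrow> 0" by blast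
    obtain M where M: "M \<subseteq> {n. p n = q n}" "infinite M" "infinite ({n. p n = q n} - M)"
      using infinite_nat_split[OF pq(1)] .
    define p' where "p' n = (if n \<in> M then a else p n)" for n
    define q' where "q' n = (if n \<in> M then b else q n)" for n
    have inf: "infinite {n. p' n = q' n}"
      by (rule infinite_super[OF _ M(3)]) (auto simp: p'_def q'_def)
    have "y i (p' n) - y i (q' n) - t i n = y i (p n) - y i (q n) - t i n" if "i \<in> I" for i n
      using ab(1) M(1) that by (auto simp: p'_def q'_def)
    then have lim': "(\<lambda>n. y i (p' n) - y i (q' n) - t i n) \<longlonglongrightarrow> 0" if "i \<in> I" for i
      using pq(2)[OF that] that by simp
    define u1 where "u1 n = y \<alpha> (p' n) - y \<alpha> (q' n)" for n
    have u1: "tracked y (t(\<alpha> := u1)) (insert \<alpha> I)" "\<forall>n. \<bar>u1 n\<bar> \<le> 2 * norm (y \<alpha>)"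
      using ext[OF inf lim'] unfolding u1_def by auto
    have "\<not> (\<lambda>n. u1 n - v n) \<longlonglongrightarrow> 0"
    proof
      assume "(\<lambda>n. u1 n - v n) \<longlonglongrightarrow> 0"
      from tendsto_diff[OF this lim0] have lim: "(\<lambda>n. u1 n - u0 n) \<longlonglongrightarrow> 0" by simp
      define c where "c = \<bar>y \<alpha> a - y \<alpha> b\<bar>"
      have "c > 0" using ab(2) by (simp add: c_def)
      from tendstoD[OF lim this] obtain N where N: "\<And>n. n \<ge> N \<Longrightarrow> \<bar>u1 n - u0 n\<bar> < c"
        by (auto simp: eventually_sequentially)
      obtain n where n: "n \<ge> N" "n \<in> M" using M(2) unfolding infinite_nat_iff_unbounded_le by blast
      have "u1 n - u0 n = y \<alpha> a - y \<alpha> b"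
        using n(2) M(1) by (auto simp: u0_def u1_def p'_def q'_def)
      then show False using N[OF n(1)] by (simp add: c_def)
    qed
    then show ?thesis using u1 by blast
  qed
qed

lemma finite_has_max_wrt:
  assumes "finite J" "J \<noteq> {}" "trans r" "\<And>x y. x \<noteq> y \<Longrightarrow> (x, y) \<in> r \<or> (y, x) \<in> r"
  shows "\<exists>m\<in>J. \<forall>x\<in>J. x = m \<or> (x, m) \<in> r"
  using assms(1,2)
proof (induction rule: finite_ne_induct)
  case (insert x F)
  then obtain m where m: "m \<in> F" "\<forall>z\<in>F. z = m \<or> (z, m) \<in> r" by blast
  show ?case
  proof (cases "(x, m) \<in> r \<or> x = m")
    case True
    then show ?thesis using m by blast
  next
    case False
    then have "(m, x) \<in> r" using assms(4) by blast
    then have "z = x \<or> (z, x) \<in> r" if "z \<in> insert x F" for z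
      using m that \<open>trans r\<close> by (metis insertE transD)
    then show ?thesis by blast
  qed
qed simp

text \<open>The recursion defines \<open>t\<close> itself, and no sequences \<open>p\<close> and \<open>q\<close> are carried from one stage to the
next. A finite set of previous indices is tracked since its last member was, and then
\<open>tracked_countable\<close> supplies new sequences for all previous indices together.\<close>

lemma tracked_transfinite:
  fixes r :: "'i rel" and y :: "'i \<Rightarrow> 'a::topological_space \<Rightarrow>\<^sub>C real"
  assumes r: "wf r" "trans r" "\<And>x y. x \<noteq> y \<Longrightarrow> (x, y) \<in> r \<or> (y, x) \<in> r" "\<And>x. countable {y. (y, x) \<in> r}"
  shows "\<exists>t. (\<forall>J. finite J \<longrightarrow> tracked y t J) \<and> (\<forall>\<alpha> n. \<bar>t \<alpha> n\<bar> \<le> 2 * norm (y \<alpha>)) \<and>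
    (\<forall>\<alpha>. (\<exists>a b. (\<forall>\<beta>. (\<beta>, \<alpha>) \<in> r \<longrightarrow> apply_bcontfun (y \<beta>) a = y \<beta> b) \<and> y \<alpha> a \<noteq> y \<alpha> b)
        \<longrightarrow> \<not> (\<lambda>n. t \<alpha> n - v \<alpha> n) \<longlonglongrightarrow> 0)"
proof -
  define pre where "pre \<alpha> = {\<beta>. (\<beta>, \<alpha>) \<in> r}" for \<alpha>
  define P where "P t \<alpha> u \<longleftrightarrow> tracked y (t(\<alpha> := u)) (insert \<alpha> (pre \<alpha>)) \<and> (\<forall>n. \<bar>u n\<bar> \<le> 2 * norm (y \<alpha>)) \<and>
    ((\<exists>a b. (\<forall>\<beta>\<in>pre \<alpha>. apply_bcontfun (y \<beta>) a = y \<beta> b) \<and> y \<alpha> a \<noteq> y \<alpha> b) \<longrightarrow> \<not> (\<lambda>n. u n - v \<alpha> n) \<longlonglongrightarrow> 0)"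
    for t \<alpha> and u :: "nat \<Rightarrow> real"
  have fin: "tracked y t J" if J: "finite J" and P: "\<And>\<alpha>. \<alpha> \<in> J \<Longrightarrow> P t \<alpha> (t \<alpha>)" for t J
  proof (cases "J = {}")
    case False
    then obtain \<mu> where \<mu>: "\<mu> \<in> J" "\<forall>\<beta>\<in>J. \<beta> = \<mu> \<or> (\<beta>, \<mu>) \<in> r"
      using finite_has_max_wrt[OF J False r(2,3)] by blast
    have "tracked y t (insert \<mu> (pre \<mu>))" using P[OF \<mu>(1)] by (simp add: P_def)
    then show ?thesis by (rule tracked_subset) (use \<mu>(2) in \<open>auto simp: pre_def\<close>)
  qed (simp add: tracked_empty)
  have "\<exists>t. \<forall>\<alpha>. P t \<alpha> (t \<alpha>)"
  proof (rule dependent_wf_choice[OF r(1)])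
    fix f g :: "'i \<Rightarrow> nat \<Rightarrow> real" and \<alpha> u
    assume fg: "\<And>\<beta>. (\<beta>, \<alpha>) \<in> r \<Longrightarrow> f \<beta> = g \<beta>"
    have "tracked y (f(\<alpha> := u)) (insert \<alpha> (pre \<alpha>)) \<longleftrightarrow> tracked y (g(\<alpha> := u)) (insert \<alpha> (pre \<alpha>))"
      by (rule tracked_cong) (use fg in \<open>auto simp: pre_def\<close>)
    then show "P f \<alpha> u = P g \<alpha> u" unfolding P_def by simp
  next
    fix \<alpha> f assume IH: "\<And>\<beta>. (\<beta>, \<alpha>) \<in> r \<Longrightarrow> P f \<beta> (f \<beta>)"
    have "tracked y f (pre \<alpha>)"
    proof (rule tracked_countable)
      show "countable (pre \<alpha>)" unfolding pre_def by (rule r(4))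
      show "tracked y f J" if "finite J" "J \<subseteq> pre \<alpha>" for J
        using that IH by (intro fin) (auto simp: pre_def)
    qed
    moreover have "\<alpha> \<notin> pre \<alpha>" using r(1) by (auto simp: pre_def)
    ultimately show "\<exists>u. P f \<alpha> u" unfolding P_def by (rule tracked_insert)
  qed
  then obtain t where t: "\<And>\<alpha>. P t \<alpha> (t \<alpha>)" by blast
  show ?thesis
  proof (intro exI[of _ t] conjI allI impI)
    show "tracked y t J" if "finite J" for J using fin[OF that] t by blast
    show "\<bar>t \<alpha> n\<bar> \<le> 2 * norm (y \<alpha>)" for \<alpha> n using t[of \<alpha>] unfolding P_def by blast
    show "\<not> (\<lambda>n. t \<alpha> n - v \<alpha> n) \<longlonglongrightarrow> 0"
      if "\<exists>a b. (\<forall>\<beta>. (\<beta>, \<alpha>) \<in> r \<longrightarrow> apply_bcontfun (y \<beta>) a = y \<beta> b) \<and> y \<alpha> a \<noteq> y \<alpha> b" for \<alpha>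
      using t[of \<alpha>] that unfolding P_def pre_def by blast
  qed
qed

text \<open>Call \<open>\<alpha>\<close> new if \<open>y \<alpha>\<close> separates two points that no earlier \<open>y \<beta>\<close> separates. The new functions separate
all points of \<open>K\<close>, so there are uncountably many, hence continuum many of them. They suffice to
enumerate all sequences of bounded functionals, and the one with index \<open>\<alpha>\<close> fails to lift \<open>t\<close> at
\<open>y \<alpha>\<close>.\<close>

theorem nontrivial_twisted_sum_if_continuum_many:
  assumes CH: "continuum_hypothesis" and K: "compact (UNIV :: 'a::linorder_topology set)"
    and nm: "\<not> metrizable_space (euclidean :: 'a topology)"
    and small: "(UNIV :: 'a set) \<lesssim> (UNIV :: real set)"
  shows "nontrivial_twisted_sum_exists c0_space (CK_space TYPE('a))"
proof -
  obtain r :: "real rel" where r: "wf r" "trans r" "\<And>x y. x \<noteq> y \<Longrightarrow> (x, y) \<in> r \<or> (y, x) \<in> r"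
      "\<And>x. countable {y. (y, x) \<in> r}"
    using CH_wellorder[OF CH] by blast
  obtain y :: "real \<Rightarrow> 'a \<Rightarrow>\<^sub>C real" where y: "UNIV \<subseteq> range y"
    using lepoll_real_continuous[OF K small] unfolding lepoll_iff by blast
  define New where "New = {\<alpha>. \<exists>a b. (\<forall>\<beta>. (\<beta>, \<alpha>) \<in> r \<longrightarrow> apply_bcontfun (y \<beta>) a = y \<beta> b) \<and> y \<alpha> a \<noteq> y \<alpha> b}"
  have "uncountable New"
  proof
    assume c: "countable New"
    have "metrizable_space (euclidean :: 'a topology)"
    proof (rule metrizable_if_countably_separated[OF K])
      show "countable (y ` New)" using c by simp
      fix a b :: 'a assume ab: "a \<noteq> b"
      obtain f :: "'a \<Rightarrow>\<^sub>C real" where f: "f a \<noteq> f b"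
      proof -
        define f where "f = Bcontfun (ramp (min a b) (max a b))"
        have lt: "min a b < max a b" using ab by (auto simp: min_def max_def)
        have "apply_bcontfun f = ramp (min a b) (max a b)"
          unfolding f_def by (rule apply_Bcontfun[OF K ramp(1)[OF K lt]])
        then have "f (min a b) = 0" "f (max a b) = 1"
          using ramp(4,5)[OF K lt] by auto
        then have "f a \<noteq> f b" by (auto simp: min_def max_def split: if_splits)
        then show thesis by (rule that)
      qed
      moreover obtain \<alpha> where "f = y \<alpha>" using y by blast
      ultimately have "\<exists>\<alpha>. \<alpha> \<in> {\<alpha>. apply_bcontfun (y \<alpha>) a \<noteq> y \<alpha> b}" by blast
      then obtain \<alpha> where \<alpha>: "\<alpha> \<in> {\<alpha>. apply_bcontfun (y \<alpha>) a \<noteq> y \<alpha> b}"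
          "\<And>\<beta>. (\<beta>, \<alpha>) \<in> r \<Longrightarrow> \<beta> \<notin> {\<alpha>. apply_bcontfun (y \<alpha>) a \<noteq> y \<alpha> b}"
        by (elim exE) (rule wfE_min[OF r(1)], assumption, blast)
      then have "\<alpha> \<in> New" unfolding New_def by blast
      with \<alpha>(1) show "\<exists>f\<in>y ` New. apply_bcontfun f a \<noteq> f b" by blast
    qed
    with nm show False by contradiction
  qed
  then have "(UNIV :: real set) \<lesssim> New" by (rule CH_uncountable[OF CH])
  with lepoll_real_seq[OF lepoll_real_functionals[OF K small]]
  have "{\<Psi> :: nat \<Rightarrow> ('a \<Rightarrow>\<^sub>C real) \<Rightarrow> real. range \<Psi> \<subseteq> {\<psi>. bounded_linear \<psi>}} \<lesssim> New"
    by (rule lepoll_trans)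
  then obtain w :: "real \<Rightarrow> nat \<Rightarrow> ('a \<Rightarrow>\<^sub>C real) \<Rightarrow> real"
    where w: "{\<Psi>. range \<Psi> \<subseteq> {\<psi>. bounded_linear \<psi>}} \<subseteq> w ` New"
    unfolding lepoll_iff by blast
  obtain t where "(\<forall>J. finite J \<longrightarrow> tracked y t J) \<and> (\<forall>\<alpha> n. \<bar>t \<alpha> n\<bar> \<le> 2 * norm (y \<alpha>)) \<and>
    (\<forall>\<alpha>. (\<exists>a b. (\<forall>\<beta>. (\<beta>, \<alpha>) \<in> r \<longrightarrow> apply_bcontfun (y \<beta>) a = y \<beta> b) \<and> y \<alpha> a \<noteq> y \<alpha> b)
        \<longrightarrow> \<not> (\<lambda>n. t \<alpha> n - w \<alpha> n (y \<alpha>)) \<longlonglongrightarrow> 0)"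
    using tracked_transfinite[OF r, of y "\<lambda>\<alpha> n. w \<alpha> n (y \<alpha>)"] by (rule exE)
  then have t: "\<And>J. finite J \<Longrightarrow> tracked y t J" "\<And>\<alpha> n. \<bar>t \<alpha> n\<bar> \<le> 2 * norm (y \<alpha>)"
    "\<And>\<alpha>. \<alpha> \<in> New \<Longrightarrow> \<not> (\<lambda>n. t \<alpha> n - w \<alpha> n (y \<alpha>)) \<longlonglongrightarrow> 0"
    by (simp_all add: New_def)
  have "\<exists>\<alpha>. y \<alpha> = f" for f using y by (metis UNIV_I imageE subsetD)
  then obtain idx where idx: "\<And>f. y (idx f) = f" by metis
  show ?thesis
  proof (rule nontrivial_twisted_sum_of_almost_linear[of "\<lambda>f. t (idx f)" 2])
    fix f g :: "'a \<Rightarrow>\<^sub>C real"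
    have "tracked y t {idx f, idx g, idx (f + g)}" by (rule t(1)) simp
    then obtain p q where pq: "\<And>i. i \<in> {idx f, idx g, idx (f + g)} \<Longrightarrow> (\<lambda>n. y i (p n) - y i (q n) - t i n) \<longlonglongrightarrow> 0"
      unfolding tracked_def by blast
    have "(\<lambda>n. (y (idx f) (p n) - y (idx f) (q n) - t (idx f) n) + (y (idx g) (p n) - y (idx g) (q n) - t (idx g) n)
        - (y (idx (f + g)) (p n) - y (idx (f + g)) (q n) - t (idx (f + g)) n)) \<longlonglongrightarrow> 0 + 0 - 0"
      by (intro tendsto_add tendsto_diff pq) auto
    then show "(\<lambda>n. t (idx (f + g)) n - (t (idx f) n + t (idx g) n)) \<longlonglongrightarrow> 0"
      by (simp add: idx plus_bcontfun.rep_eq algebra_simps)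
  next
    fix a and f :: "'a \<Rightarrow>\<^sub>C real"
    have "tracked y t {idx f, idx (a *\<^sub>R f)}" by (rule t(1)) simp
    then obtain p q where pq: "\<And>i. i \<in> {idx f, idx (a *\<^sub>R f)} \<Longrightarrow> (\<lambda>n. y i (p n) - y i (q n) - t i n) \<longlonglongrightarrow> 0"
      unfolding tracked_def by blast
    have "(\<lambda>n. a * (y (idx f) (p n) - y (idx f) (q n) - t (idx f) n)
        - (y (idx (a *\<^sub>R f)) (p n) - y (idx (a *\<^sub>R f)) (q n) - t (idx (a *\<^sub>R f)) n)) \<longlonglongrightarrow> a * 0 - 0"
      by (intro tendsto_mult tendsto_diff tendsto_const pq) auto
    then show "(\<lambda>n. t (idx (a *\<^sub>R f)) n - a * t (idx f) n) \<longlonglongrightarrow> 0"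
      by (simp add: idx scaleR_bcontfun.rep_eq algebra_simps)
  next
    fix \<psi> :: "nat \<Rightarrow> ('a \<Rightarrow>\<^sub>C real) \<Rightarrow> real" assume \<psi>: "\<And>n. bounded_linear (\<psi> n)"
    then obtain \<alpha> where \<alpha>: "\<alpha> \<in> New" "w \<alpha> = \<psi>"
      using w by (metis (mono_tags, lifting) imageE image_subset_iff mem_Collect_eq subsetD)
    have nl: "\<not> (\<lambda>n. t \<alpha> n - \<psi> n (y \<alpha>)) \<longlonglongrightarrow> 0"
      using t(3)[OF \<alpha>(1)] \<alpha>(2) by simp
    have "tracked y t {\<alpha>, idx (y \<alpha>)}" by (rule t(1)) simp
    then obtain p q where pq: "\<And>i. i \<in> {\<alpha>, idx (y \<alpha>)} \<Longrightarrow> (\<lambda>n. y i (p n) - y i (q n) - t i n) \<longlonglongrightarrow> 0"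
      unfolding tracked_def by blast
    have "(\<lambda>n. (y (idx (y \<alpha>)) (p n) - y (idx (y \<alpha>)) (q n) - t (idx (y \<alpha>)) n) - (y \<alpha> (p n) - y \<alpha> (q n) - t \<alpha> n)) \<longlonglongrightarrow> 0 - 0"
      by (intro tendsto_diff pq) auto
    then have d: "(\<lambda>n. t \<alpha> n - t (idx (y \<alpha>)) n) \<longlonglongrightarrow> 0" by (simp add: idx)
    have "\<not> (\<lambda>n. t (idx (y \<alpha>)) n - \<psi> n (y \<alpha>)) \<longlonglongrightarrow> 0"
    proof
      assume "(\<lambda>n. t (idx (y \<alpha>)) n - \<psi> n (y \<alpha>)) \<longlonglongrightarrow> 0"
      from tendsto_add[OF d this] nl show False by simp
    qed
    then show "\<exists>f. \<not> (\<lambda>n. t (idx f) n - \<psi> n f) \<longlonglongrightarrow> 0" by blast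
  next
    show "\<bar>t (idx f) n\<bar> \<le> 2 * norm f" for f n using t(2)[of "idx f" n] by (simp add: idx)
  qed (rule bcontfun_Cauchy_convergent)
qed

theorem corollary8p4:
  assumes "continuum_hypothesis"
    and "compact (UNIV :: 'a::linorder_topology set)"
    and "\<not> metrizable_space (euclidean :: 'a topology)"
  shows "nontrivial_twisted_sum_exists c0_space (CK_space TYPE('a))"
proof (cases "(UNIV :: 'a set) \<lesssim> (UNIV :: real set)")
  case True
  then show ?thesis by (rule nontrivial_twisted_sum_if_continuum_many[OF assms])
next
  case False
  obtain r :: "real rel" where r: "wf r" "trans r" "\<And>x y. x \<noteq> y \<Longrightarrow> (x, y) \<in> r \<or> (y, x) \<in> r"
      "\<And>x. countable {y. (y, x) \<in> r}"
    using CH_wellorder[OF assms(1)] by blast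
  obtain E and c :: "real \<Rightarrow> 'a" where chain: "uncountable E"
    "(\<forall>\<alpha>\<in>E. \<forall>\<beta>\<in>E. (\<alpha>, \<beta>) \<in> r \<longrightarrow> c \<alpha> < c \<beta>) \<or> (\<forall>\<alpha>\<in>E. \<forall>\<beta>\<in>E. (\<alpha>, \<beta>) \<in> r \<longrightarrow> c \<beta> < c \<alpha>)"
    by (rule lepoll_continuum_or_chain[OF r(1,2,4) False])
  show ?thesis by (rule nontrivial_twisted_sum_if_uncountable_chain[OF assms(2) r chain])
qed

end
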